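(* Let $V\subset\mathbb{P}^{n-1}$ be an irreducible variety of codimension $c$, not contained in the isotropic quadric $Q=\mathcal V(\psi^T\psi)$, with defining ideal $I_V\subset\mathbb{R}[\psi_1,\dots,\psi_n]$, and let $H\in\mathrm{Sym}^2(\mathbb{R}^n)$. The set of critical points of the problem of minimizing the Rayleigh quotient $\frac{\psi^TH\psi}{\psi^T\psi}$ over $V$ is the zero set of the critical ideal $$I_{\mathrm{crit}}(V,H):=\left(I_V+\left\langle (c+1)\text{-minors of }\begin{pmatrix}(\psi^T\psi)\,\psi^TH-(\psi^TH\psi)\,\psi^T\\ \mathrm{Jac}(I_V)\end{pmatrix}\right\rangle\right):\left(I_{V_{\mathrm{sing}}}\cdot\psi^T\psi\right)^\infty$$ with $I_{V_{\mathrm{sing}}}$ the ideal of the singular locus of $V$ and $\mathrm{Jac}(I_V)$ the Jacobian of the generators of $I_V$.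
   Context: Vectors $\psi=(\psi_1,\dots,\psi_n)^T$ are columns and $\psi^T\psi=\sum_i\psi_i^2$ (complex bilinear, not Hermitian). $V$ is a complex projective variety. A critical point is a nonsingular point $\hat\psi\in V$ with $\hat\psi^T\hat\psi\neq0$ such that the gradient $\nabla_\psi\left(\frac{\psi^TH\psi}{\psi^T\psi}\right)$ evaluated at $\hat\psi$ is in $(T_{\hat\psi}V)^\perp$, where $T_{\hat\psi}V$ is the tangent space and $(T_{\hat\psi}V)^\perp$ is the row span of $\mathrm{Jac}(I_V)$ evaluated at $\hat\psi$. The rows of $\mathrm{Jac}(I_V)$ are the gradients of the generators of $I_V$, and $I:J^\infty$ denotes saturation.
   Formalization: Equality fails for V=P^{n-1}, n≥2, H=identity (isotropic points are zeros); proved instead: the zero set of I_crit is the Zariski closure of the critical points, which are its zeros off V_sing and Q, with equality if they are finite in number. *)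

theory Defs
  imports "HOL-Analysis.Analysis" "HOL-Library.Poly_Mapping" "Jordan_Normal_Form.Determinant"
begin

no_notation Matrix.vec_index (infixl "$" 100)

section \<open>Polynomials in the variables indexed by a finite type\<close>

type_synonym ('n, 'a) mpoly = "('n \<Rightarrow>\<^sub>0 nat) \<Rightarrow>\<^sub>0 'a"

definition const_poly :: "'a \<Rightarrow> ('n, 'a::zero) mpoly" where
  "const_poly a = Poly_Mapping.single 0 a"

definition var_vec :: "('n, 'a::zero_neq_one) mpoly ^ 'n" where
  "var_vec = (\<chi> i. Poly_Mapping.single (Poly_Mapping.single i 1) 1)"

definition eval_poly :: "('n::finite, 'a::comm_semiring_1) mpoly \<Rightarrow> 'a ^ 'n \<Rightarrow> 'a" where
  "eval_poly p x =
     (\<Sum>m\<in>Poly_Mapping.keys p. Poly_Mapping.lookup p m * (\<Prod>i\<in>UNIV. (x $ i) ^ Poly_Mapping.lookup m i))"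

definition partial :: "'n \<Rightarrow> ('n, 'a::comm_semiring_1) mpoly \<Rightarrow> ('n, 'a) mpoly" where
  "partial i p =
     (\<Sum>m\<in>Poly_Mapping.keys p.
        Poly_Mapping.single (m - Poly_Mapping.single i 1)
          (of_nat (Poly_Mapping.lookup m i) * Poly_Mapping.lookup p m))"

definition poly_grad :: "('n::finite, 'a::comm_semiring_1) mpoly \<Rightarrow> ('n, 'a) mpoly ^ 'n" where
  "poly_grad p = (\<chi> i. partial i p)"

definition homogeneous :: "('n::finite, 'a::zero) mpoly \<Rightarrow> bool" where
  "homogeneous p \<longleftrightarrow> (\<exists>d. \<forall>m\<in>Poly_Mapping.keys p. (\<Sum>i\<in>UNIV. Poly_Mapping.lookup m i) = d)"

definition complexify :: "('n, real) mpoly \<Rightarrow> ('n, complex) mpoly" where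
  "complexify = Poly_Mapping.map complex_of_real"


section \<open>Ideals\<close>

lemma module_mult: "Modules.module ((*) :: 'a::comm_ring_1 \<Rightarrow> 'a \<Rightarrow> 'a)"
  by unfold_locales (simp_all add: algebra_simps)

definition ideal_gen :: "'a::comm_ring_1 set \<Rightarrow> 'a set" where
  "ideal_gen S = Modules.module.span (*) S"

definition ideal_sum :: "'a::comm_ring_1 set \<Rightarrow> 'a set \<Rightarrow> 'a set" where
  "ideal_sum I J = {f + g | f g. f \<in> I \<and> g \<in> J}"

definition ideal_prod :: "'a::comm_ring_1 set \<Rightarrow> 'a set \<Rightarrow> 'a set" where
  "ideal_prod I J = ideal_gen {f * g | f g. f \<in> I \<and> g \<in> J}"

primrec ideal_power :: "'a::comm_ring_1 set \<Rightarrow> nat \<Rightarrow> 'a set" where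
  "ideal_power J 0 = UNIV"
| "ideal_power J (Suc k) = ideal_prod J (ideal_power J k)"

definition saturation :: "'a::comm_ring_1 set \<Rightarrow> 'a set \<Rightarrow> 'a set" where
  "saturation I J = {f. \<exists>k. \<forall>g\<in>ideal_power J k. f * g \<in> I}"


section \<open>Complex projective space and its Zariski topology\<close>

text \<open>A point of the projective space is a one-dimensional subspace of \<open>complex ^ 'n\<close>, so the
  projective space has dimension \<open>CARD('n) - 1\<close>.\<close>

definition proj_space :: "(complex ^ 'n) set set" where
  "proj_space = {vec.span {\<psi>} | \<psi>. \<psi> \<noteq> 0}"

definition proj_zeros :: "('n::finite, complex) mpoly set \<Rightarrow> (complex ^ 'n) set set" where
  "proj_zeros S = {L \<in> proj_space. \<forall>f\<in>S. \<forall>\<psi>\<in>L - {0}. eval_poly f \<psi> = 0}"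

definition real_zeros :: "('n::finite, real) mpoly set \<Rightarrow> (complex ^ 'n) set set" where
  "real_zeros S = proj_zeros (complexify ` S)"

definition vanishing_ideal :: "(complex ^ 'n) set set \<Rightarrow> ('n::finite, real) mpoly set" where
  "vanishing_ideal V = {f. \<forall>L\<in>V. \<forall>\<psi>\<in>L - {0}. eval_poly (complexify f) \<psi> = 0}"

definition zariski_closed :: "(complex ^ 'n::finite) set set \<Rightarrow> bool" where
  "zariski_closed Z \<longleftrightarrow> (\<exists>S. (\<forall>f\<in>S. homogeneous f) \<and> Z = proj_zeros S)"

definition irreducible_variety :: "(complex ^ 'n::finite) set set \<Rightarrow> bool" where
  "irreducible_variety Z \<longleftrightarrow> zariski_closed Z \<and> Z \<noteq> {} \<and>
     (\<forall>A B. zariski_closed A \<and> zariski_closed B \<and> Z = A \<union> B \<longrightarrow> Z = A \<or> Z = B)"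

definition irreducible_chain :: "(complex ^ 'n::finite) set set \<Rightarrow> nat \<Rightarrow> bool" where
  "irreducible_chain V d \<longleftrightarrow>
     (\<exists>Z :: nat \<Rightarrow> (complex ^ 'n) set set.
        (\<forall>i\<le>d. irreducible_variety (Z i) \<and> Z i \<subseteq> V) \<and> (\<forall>i<d. Z i \<subset> Z (Suc i)))"

definition has_dimension :: "(complex ^ 'n::finite) set set \<Rightarrow> nat \<Rightarrow> bool" where
  "has_dimension V d \<longleftrightarrow> irreducible_chain V d \<and> (\<forall>e. irreducible_chain V e \<longrightarrow> e \<le> d)"

definition has_codimension :: "(complex ^ 'n::finite) set set \<Rightarrow> nat \<Rightarrow> bool" where
  "has_codimension V c \<longleftrightarrow> (\<exists>d. has_dimension V d \<and> d + c = CARD('n) - 1)"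


section \<open>Critical points of the Rayleigh quotient\<close>

text \<open>Here \<open>gs\<close> is a list of generators of the ideal of a variety \<open>V\<close> of codimension \<open>c\<close>.
  The row span below is the space \<open>(T\<^sub>\<psi> V)\<^sup>\<bottom>\<close>; a point is nonsingular if the Jacobian
  has rank \<open>c\<close> there, that is, if the tangent space has the dimension of \<open>V\<close>.\<close>

definition jac_row_span :: "('n::finite, real) mpoly list \<Rightarrow> complex ^ 'n \<Rightarrow> (complex ^ 'n) set" where
  "jac_row_span gs \<psi> =
     vec.span {\<chi> i. eval_poly (complexify (poly_grad g $ i)) \<psi> | g. g \<in> set gs}"

definition singular_locus ::
    "('n::finite, real) mpoly list \<Rightarrow> nat \<Rightarrow> (complex ^ 'n) set set \<Rightarrow> (complex ^ 'n) set set" where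
  "singular_locus gs c V = {L \<in> V. \<not> (\<forall>\<psi>\<in>L - {0}. vec.dim (jac_row_span gs \<psi>) = c)}"

definition holo_grad :: "(complex ^ 'n::finite \<Rightarrow> complex) \<Rightarrow> complex ^ 'n \<Rightarrow> complex ^ 'n" where
  "holo_grad F \<psi> = (\<chi> i. deriv (\<lambda>t. F (\<psi> + axis i t)) 0)"

definition rayleigh_quotient :: "real ^ 'n ^ 'n \<Rightarrow> complex ^ 'n::finite \<Rightarrow> complex" where
  "rayleigh_quotient H \<psi> =
     scalar_product \<psi> (map_matrix complex_of_real H *v \<psi>) / scalar_product \<psi> \<psi>"

definition critical_points ::
    "('n::finite, real) mpoly list \<Rightarrow> nat \<Rightarrow> (complex ^ 'n) set set \<Rightarrow> real ^ 'n ^ 'n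
      \<Rightarrow> (complex ^ 'n) set set" where
  "critical_points gs c V H =
     {L \<in> V - singular_locus gs c V.
        \<forall>\<psi>\<in>L - {0}. scalar_product \<psi> \<psi> \<noteq> 0 \<and>
          holo_grad (rayleigh_quotient H) \<psi> \<in> jac_row_span gs \<psi>}"


section \<open>The critical ideal\<close>

definition norm_poly :: "('n::finite, real) mpoly" where
  "norm_poly = scalar_product var_vec var_vec"

definition isotropic_quadric :: "(complex ^ 'n::finite) set set" where
  "isotropic_quadric = real_zeros {norm_poly}"

definition rayleigh_row :: "real ^ 'n ^ 'n \<Rightarrow> ('n::finite, real) mpoly ^ 'n" where
  "rayleigh_row H =
     (let A = map_matrix const_poly H
      in norm_poly *s (var_vec v* A) - scalar_product var_vec (A *v var_vec) *s var_vec)"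

text \<open>The \<open>k\<close>-minors of the matrix with list of rows \<open>R\<close>. Since there is no order on the column
  indices, all injective selections of rows and columns are allowed; this adds only the negatives
  of the usual minors.\<close>

definition minors :: "nat \<Rightarrow> ('a::comm_ring_1 ^ 'n) list \<Rightarrow> 'a set" where
  "minors k R =
     {Determinant.det (Matrix.mat k k (\<lambda>(a, b). (R ! r a) $ s b)) | r s.
        inj_on r {..<k} \<and> r ` {..<k} \<subseteq> {..<length R} \<and> inj_on s {..<k}}"

text \<open>The zero set of a saturation \<open>I : J\<^sup>\<infinity>\<close> is the Zariski closure of the zeros of \<open>I\<close> that are not
  zeros of \<open>J\<close>. It can contain singular or isotropic points when there are infinitely many critical
  points: for \<open>H = 1\<close> and \<open>V\<close> the whole projective space the critical ideal is zero, while the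
  critical points are the non-isotropic points only.\<close>

definition critical_ideal ::
    "('n::finite, real) mpoly list \<Rightarrow> nat \<Rightarrow> (complex ^ 'n) set set \<Rightarrow> real ^ 'n ^ 'n
      \<Rightarrow> ('n, real) mpoly set" where
  "critical_ideal gs c V H =
     saturation
       (ideal_sum (vanishing_ideal V)
          (ideal_gen (minors (c + 1) (rayleigh_row H # map poly_grad gs))))
       (ideal_prod (vanishing_ideal (singular_locus gs c V)) (ideal_gen {norm_poly}))"

end

theory Submission
  imports Defs "HOL-Computational_Algebra.Fundamental_Theorem_Algebra"
begin

text \<open>
  A nonsingular non-isotropic point of \<open>V\<close> is critical iff the gradient of the quotient, a multiple of
  the first row of the augmented Jacobian, lies in the \<open>c\<close>-dimensional span of the other rows, that
  is, iff the \<open>(c+1)\<close>-minors vanish. This needs that the Jacobian of \<open>V\<close> has rank at most \<open>c\<close>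
  everywhere, so that the singular locus is cut out in \<open>V\<close> by the \<open>c\<close>-minors. For the bound, the
  homogeneous ideals of a chain of irreducible varieties of length \<open>d\<close> in \<open>V\<close> yield \<open>d+1\<close> variables
  independent modulo the ideal \<open>P\<close> of \<open>V\<close>; the remaining \<open>c\<close> variables give a triangular system of
  at most \<open>c\<close> relations in \<open>P\<close> which generates \<open>P\<close> up to factors outside \<open>P\<close>, so at a general point
  the gradients of at most \<open>c\<close> polynomials span all gradients.

  The zero set of the saturation is the closure of the critical points: a real polynomial \<open>f\<close> that
  vanishes at all critical points makes \<open>f g\<close>, for \<open>g\<close> in the ideal \<open>J\<close> by which one saturates, vanish
  on all zeros of the base ideal. By the Nullstellensatz and the finite generation of \<open>J\<close>, a power of
  \<open>f\<close> lies in the saturation. Complex polynomials reduce to real ones since the set of critical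
  points is stable under conjugation.

  Both the Nullstellensatz and the comparison of dimensions eliminate one variable at a time modulo a
  prime ideal, by means of a relation of minimal degree.
\<close>

section \<open>Elimination modulo a prime ideal\<close>

text \<open>Residue fields and their fractions are replaced by congruences in the polynomial ring.
  An element outside the prime ideal \<open>P\<close> plays the part of a denominator: an identity
  holds after multiplication by it, and points are chosen where it does not vanish. Hence the
  constant care about leading coefficients outside \<open>P\<close>.

  The dimension of \<open>V\<close> counts projective varieties, while gradients live in all n
  affine coordinates. A chain of length d gives d + 1 independent variables, one from a point of its
  smallest member and one for each strict inclusion. From d + c = n - 1 it follows that n - (d + 1)
  = c variables are left over, which is where the bound c on the rank comes from.

  A bound at a general point is enough, because a (c+1)-minor that is nonzero at one point of
  \<open>V\<close> lies outside the prime ideal of \<open>V\<close>. It is therefore nonzero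
  together with all the denominators at some other point of \<open>V\<close>, where the bound is
  known.\<close>

hide_const (open) module.smult

text \<open>Meant for the polynomials in some of the variables, as a subset of the ring of all
  polynomials. A further variable is then an element \<open>x\<close> at which polynomials over
  \<open>S\<close> are evaluated, and the type stays the same.\<close>

locale coeff_ring =
  fixes S :: "'a::comm_ring_1 set"
  assumes zero_mem: "0 \<in> S" and one_mem: "1 \<in> S"
    and add_mem: "a \<in> S \<Longrightarrow> b \<in> S \<Longrightarrow> a + b \<in> S"
    and uminus_mem: "a \<in> S \<Longrightarrow> - a \<in> S"
    and mult_mem: "a \<in> S \<Longrightarrow> b \<in> S \<Longrightarrow> a * b \<in> S"
begin


lemma diff_mem: "a \<in> S \<Longrightarrow> b \<in> S \<Longrightarrow> a - b \<in> S"
  using add_mem[of a "- b"] uminus_mem by simp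

lemma power_mem: "a \<in> S \<Longrightarrow> a ^ k \<in> S"
  by (induction k) (auto simp: one_mem mult_mem)

lemma sum_mem: "(\<And>i. i \<in> A \<Longrightarrow> f i \<in> S) \<Longrightarrow> sum f A \<in> S"
  by (induction A rule: infinite_finite_induct) (auto simp: zero_mem add_mem)

definition poly_over :: "'a poly \<Rightarrow> bool" where
  "poly_over p \<longleftrightarrow> (\<forall>i. coeff p i \<in> S)"

lemma poly_over_0 [simp]: "poly_over 0"
  by (simp add: poly_over_def zero_mem)

lemma poly_over_1 [simp]: "poly_over 1"
  by (simp add: poly_over_def coeff_1 zero_mem one_mem)

lemma poly_over_add: "poly_over p \<Longrightarrow> poly_over q \<Longrightarrow> poly_over (p + q)"
  by (simp add: poly_over_def add_mem)

lemma poly_over_diff: "poly_over p \<Longrightarrow> poly_over q \<Longrightarrow> poly_over (p - q)"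
  by (simp add: poly_over_def diff_mem)

lemma poly_over_uminus: "poly_over p \<Longrightarrow> poly_over (- p)"
  by (simp add: poly_over_def uminus_mem)

lemma poly_over_smult: "a \<in> S \<Longrightarrow> poly_over p \<Longrightarrow> poly_over (smult a p)"
  by (simp add: poly_over_def mult_mem)

lemma poly_over_mult: "poly_over p \<Longrightarrow> poly_over q \<Longrightarrow> poly_over (p * q)"
  by (auto simp: poly_over_def coeff_mult intro!: sum_mem mult_mem)

lemma poly_over_monom: "a \<in> S \<Longrightarrow> poly_over (monom a k)"
  by (simp add: poly_over_def zero_mem)

lemma poly_over_coeff: "poly_over p \<Longrightarrow> coeff p i \<in> S"
  by (simp add: poly_over_def)

text \<open>Powers of the leading coefficient stand in for division by it. The bound on
  \<open>degree q\<close> is for \<open>elimination\<close>, where the quotient has to be shorter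
  than the minimal relation.\<close>

lemma pseudo_division:
  assumes "poly_over g" "degree g \<ge> 1" "poly_over p"
  shows "\<exists>e q r. poly_over q \<and> poly_over r \<and> smult (lead_coeff g ^ e) p = q * g + r \<and>
    degree r < degree g \<and> degree q \<le> degree p - degree g"
  using assms(3)
proof (induction "degree p" arbitrary: p rule: less_induct)
  case less
  show ?case
  proof (cases "degree p < degree g")
    case True
    then show ?thesis
      using less.prems by (intro exI[of _ 0] exI[of _ p]) auto
  next
    case False
    let ?l = "lead_coeff g"
    define m where "m = monom (lead_coeff p) (degree p - degree g)"
    define p' where "p' = smult ?l p - m * g"
    have m: "poly_over m"
      using less.prems by (simp add: m_def poly_over_monom poly_over_coeff)
    have p': "poly_over p'"
      using less.prems assms(1) m
      by (auto simp: p'_def intro!: poly_over_diff poly_over_smult poly_over_mult poly_over_coeff)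
    have "degree (m * g) \<le> degree p"
      using degree_mult_le[of m g] degree_monom_le[of "lead_coeff p" "degree p - degree g"] False
      by (simp add: m_def)
    then have le: "degree p' \<le> degree p"
      unfolding p'_def by (intro degree_diff_le) (auto intro: order_trans[OF degree_smult_le])
    have "coeff p' (degree p) = 0"
      using False by (simp add: p'_def m_def coeff_monom_mult)
    \<comment> \<open>If the degrees agreed, \<open>p'\<close> would have leading coefficient 0,
      hence be 0 and have degree 0, against \<open>degree p\<close> \<ge> \<open>degree g\<close>
      \<ge> 1.\<close>
    then have "degree p' \<noteq> degree p"
      using assms(2) False by (metis leading_coeff_0_iff degree_0 not_less_zero le_zero_eq not_one_le_zero linorder_not_less)
    with le have lt: "degree p' < degree p" by simp
    from less.hyps[OF lt p'] obtain e q r where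
      "poly_over q" "poly_over r" "smult (?l ^ e) p' = q * g + r"
      "degree r < degree g" "degree q \<le> degree p' - degree g" by blast
    moreover have "smult (?l ^ Suc e) p = (q + smult (?l ^ e) m) * g + r"
    proof -
      have "smult (?l ^ Suc e) p = smult (?l ^ e) (p' + m * g)"
        by (simp add: p'_def mult.commute)
      also have "\<dots> = smult (?l ^ e) p' + smult (?l ^ e) m * g"
        by (simp add: smult_add_right)
      finally show ?thesis
        using \<open>smult (?l ^ e) p' = q * g + r\<close> by (simp add: algebra_simps)
    qed
    moreover have "degree (q + smult (?l ^ e) m) \<le> degree p - degree g"
      using \<open>degree q \<le> degree p' - degree g\<close> le
        order_trans[OF degree_smult_le degree_monom_le[of "lead_coeff p" "degree p - degree g"], of "?l ^ e"]
      by (intro degree_add_le) (auto simp: m_def)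
    moreover have "poly_over (q + smult (?l ^ e) m)"
      using m \<open>poly_over q\<close> assms(1)
      by (auto intro!: poly_over_add poly_over_smult power_mem poly_over_coeff)
    ultimately show ?thesis by blast
  qed
qed

end

locale prime_subset =
  fixes P :: "'a::comm_ring_1 set"
  assumes ideal_zero: "0 \<in> P"
    and ideal_add: "a \<in> P \<Longrightarrow> b \<in> P \<Longrightarrow> a + b \<in> P"
    and ideal_mult: "b \<in> P \<Longrightarrow> a * b \<in> P"
    and one_notin: "1 \<notin> P"
    and prime_ideal: "a * b \<in> P \<Longrightarrow> a \<in> P \<or> b \<in> P"
begin


lemma ideal_mult': "b \<in> P \<Longrightarrow> b * a \<in> P"
  using ideal_mult[of b a] by (simp add: mult.commute)

lemma ideal_uminus: "a \<in> P \<Longrightarrow> - a \<in> P"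
  using ideal_mult[of a "- 1"] by simp

lemma ideal_diff: "a \<in> P \<Longrightarrow> b \<in> P \<Longrightarrow> a - b \<in> P"
  using ideal_add[of a "- b"] ideal_uminus by simp

lemma ideal_sum: "(\<And>i. i \<in> A \<Longrightarrow> f i \<in> P) \<Longrightarrow> sum f A \<in> P"
  by (induction A rule: infinite_finite_induct) (auto simp: ideal_zero ideal_add)

lemma power_notin: "a \<notin> P \<Longrightarrow> a ^ k \<notin> P"
  by (induction k) (auto simp: one_notin dest: prime_ideal)

lemma prod_notin: "(\<And>i. i \<in> A \<Longrightarrow> f i \<notin> P) \<Longrightarrow> prod f A \<notin> P"
  by (induction A rule: infinite_finite_induct) (auto simp: one_notin dest: prime_ideal)

lemma poly_in_ideal: "(\<And>i. coeff p i \<in> P) \<Longrightarrow> poly p x \<in> P"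
  unfolding poly_altdef by (auto intro!: ideal_sum ideal_mult')

text \<open>Makes degree and leading coefficient meaningful modulo \<open>P\<close>: what remains is
  0 or has its leading coefficient outside \<open>P\<close>, and values change only by elements of
  \<open>P\<close>.\<close>

definition strip :: "'a poly \<Rightarrow> 'a poly" where
  "strip = map_poly (\<lambda>c. if c \<in> P then 0 else c)"

lemma coeff_strip: "coeff (strip p) i = (if coeff p i \<in> P then 0 else coeff p i)"
  by (simp add: strip_def coeff_map_poly)

lemma degree_strip_le: "degree (strip p) \<le> degree p"
  by (rule degree_le) (simp add: coeff_strip coeff_eq_0)

lemma poly_strip: "poly (strip p) x - poly p x \<in> P"
proof -
  have "poly (strip p - p) x \<in> P"
    by (rule poly_in_ideal) (auto simp: coeff_strip ideal_zero ideal_uminus)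
  then show ?thesis by simp
qed

lemma poly_strip_iff: "poly (strip p) x \<in> P \<longleftrightarrow> poly p x \<in> P"
  using poly_strip[of p x] ideal_add ideal_diff
  by (metis diff_add_cancel add_diff_cancel_left' diff_diff_eq2)

lemma strip_eq_0: "lead_coeff (strip p) \<in> P \<Longrightarrow> strip p = 0"
  by (metis coeff_strip leading_coeff_0_iff)

end

locale prime_extension = coeff_ring S + prime_subset P
  for S P :: "'a::comm_ring_1 set" +
  fixes x :: 'a
begin


text \<open>Modulo \<open>P\<close>, an algebraic equation for \<open>x\<close> over the image of
  \<open>S\<close>. The condition on the leading coefficient keeps the equation from degenerating
  and supplies the denominator for pseudo-division.\<close>

definition relation :: "'a poly \<Rightarrow> bool" where
  "relation p \<longleftrightarrow> poly_over p \<and> poly p x \<in> P \<and> lead_coeff p \<notin> P"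

definition min_relation :: "'a poly \<Rightarrow> bool" where
  "min_relation g \<longleftrightarrow> relation g \<and> (\<forall>p. relation p \<longrightarrow> degree g \<le> degree p)"

lemma poly_over_strip: "poly_over p \<Longrightarrow> poly_over (strip p)"
  by (simp add: poly_over_def coeff_strip zero_mem)

lemma min_relation_exists:
  assumes "relation p" shows "\<exists>g. min_relation g"
  using exists_least_iff[of "\<lambda>d. \<exists>p. relation p \<and> degree p = d"] assms
  unfolding min_relation_def by (metis linorder_not_less)

text \<open>Otherwise \<open>strip r\<close> would be a relation of degree below \<open>m\<close>.
  The bound \<open>m\<close> is left free so that, if there is no relation at all, any number above
  \<open>degree r\<close> can be taken.\<close>

lemma coeffs_in_ideal:
  assumes "\<And>p. relation p \<Longrightarrow> m \<le> degree p" "poly_over r" "degree r < m" "poly r x \<in> P"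
  shows "coeff r i \<in> P"
proof (rule ccontr)
  assume "coeff r i \<notin> P"
  then have "strip r \<noteq> 0"
    using ideal_zero by (metis coeff_strip coeff_0)
  then have "relation (strip r)"
    using assms strip_eq_0 by (auto simp: relation_def poly_over_strip poly_strip_iff)
  then show False
    using assms(1,3) degree_strip_le[of r] by force
qed

lemma coeffs_in_ideal_transcendental:
  assumes "\<nexists>p. relation p" "poly_over r" "poly r x \<in> P"
  shows "coeff r i \<in> P"
  using coeffs_in_ideal[of "Suc (degree r)" r i] assms by auto

text \<open>The value of a constant relation is its leading coefficient, which cannot lie both in
  \<open>P\<close> and outside.\<close>

lemma min_relation_degree:
  assumes "min_relation g" shows "degree g \<ge> 1"
proof (rule ccontr)
  assume "\<not> degree g \<ge> 1"
  then have "degree g = 0" by simp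
  then obtain c where "g = [:c:]" by (metis degree_eq_zeroE)
  then show False
    using assms by (auto simp: min_relation_def relation_def)
qed

text \<open>As a minimal polynomial does, \<open>g\<close> divides whatever has its value in
  \<open>P\<close>, up to a denominator and modulo \<open>P\<close>: the pseudo-remainder is shorter
  than \<open>g\<close>, so \<open>coeffs_in_ideal\<close> applies to it.\<close>

lemma min_relation_reduce:
  assumes g: "min_relation g" and p: "poly_over p" "poly p x \<in> P"
  shows "\<exists>e q r. poly_over q \<and> (\<forall>i. coeff r i \<in> S \<inter> P) \<and>
    smult (lead_coeff g ^ e) p = q * g + r"
proof -
  obtain e q r where *: "poly_over q" "poly_over r" "smult (lead_coeff g ^ e) p = q * g + r"
    "degree r < degree g"
    using pseudo_division[of g p] min_relation_degree[OF g] g p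
    unfolding min_relation_def relation_def by blast
  have "poly r x = lead_coeff g ^ e * poly p x - poly q x * poly g x"
    using arg_cong[OF *(3), of "\<lambda>f. poly f x"] by simp
  also have "\<dots> \<in> P"
    using g p by (auto simp: min_relation_def relation_def intro!: ideal_diff ideal_mult)
  finally have "coeff r i \<in> P" for i
    using coeffs_in_ideal[of "degree g" r i] * g by (auto simp: min_relation_def)
  then show ?thesis using *(1-3) unfolding poly_over_def by blast
qed

text \<open>Modulo \<open>P\<close> this inverts the nonzero algebraic element
  \<open>poly p x\<close> up to the denominator \<open>h\<close>. A condition that involves
  \<open>x\<close> is thereby traded for one over \<open>S\<close>, as an induction on the variables
  requires.\<close>

lemma elimination:
  assumes g: "min_relation g" and p: "poly_over p" "poly p x \<notin> P"
  shows "\<exists>v h. poly_over v \<and> h \<in> S \<and> h \<notin> P \<and> poly v x * poly p x - h \<in> P"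
proof -
  txt \<open>A \<open>w\<close> of minimal degree congruent to a multiple of \<open>p\<close> is constant: otherwise the
    pseudo-division of \<open>g\<close> by \<open>w\<close> would exhibit a relation of smaller degree than \<open>g\<close>.\<close>
  define W where "W w \<longleftrightarrow> poly_over w \<and> poly w x \<notin> P \<and>
    (\<exists>v. poly_over v \<and> poly v x * poly p x - poly w x \<in> P)" for w
  have W_strip: "W (strip w)" if "W w" for w
  proof -
    from that obtain v where v: "poly_over v" "poly v x * poly p x - poly w x \<in> P"
      by (auto simp: W_def)
    have "poly v x * poly p x - poly (strip w) x \<in> P"
      using ideal_diff[OF v(2) poly_strip[of w x]] by simp
    then show ?thesis
      using that v unfolding W_def by (auto simp: poly_over_strip poly_strip_iff)
  qed
  have "W p"
    using p by (auto simp: W_def ideal_zero intro!: exI[of _ 1])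
  then obtain w0 where w0: "W w0" "\<And>u. W u \<Longrightarrow> degree w0 \<le> degree u"
    using exists_least_iff[of "\<lambda>d. \<exists>p. W p \<and> degree p = d"] by (metis linorder_not_less)
  \<comment> \<open>Stripping keeps the degree minimal and puts the leading coefficient outside
    \<open>P\<close>, so that its powers may serve as denominators in the division by
    \<open>w\<close>.\<close>
  define w where "w = strip w0"
  have w: "W w" "\<And>u. W u \<Longrightarrow> degree w \<le> degree u"
    using W_strip[OF w0(1)] w0(2) degree_strip_le[of w0] by (auto simp: w_def intro: order_trans)
  have lw: "lead_coeff w \<notin> P"
    using w(1) ideal_zero strip_eq_0[of w0] by (auto simp: W_def w_def)
  from w(1) obtain v where v: "poly_over v" "poly v x * poly p x - poly w x \<in> P"
    and wS: "poly_over w" and wP: "poly w x \<notin> P" by (auto simp: W_def)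
  have gP: "poly_over g" "poly g x \<in> P" "lead_coeff g \<notin> P"
    using g by (auto simp: min_relation_def relation_def)
  have g1: "degree g \<ge> 1" by (rule min_relation_degree[OF g])
  have deg_lt: "degree w < degree g"
  proof (rule ccontr)
    assume not: "\<not> degree w < degree g"
    obtain e q r where *: "poly_over q" "poly_over r" "smult (lead_coeff g ^ e) w = q * g + r"
      "degree r < degree g"
      using pseudo_division[OF gP(1) g1 wS] by blast
    have r: "poly r x = lead_coeff g ^ e * poly w x - poly q x * poly g x"
      using arg_cong[OF *(3), of "\<lambda>f. poly f x"] by simp
    have "poly r x \<notin> P"
    proof
      assume "poly r x \<in> P"
      then have "lead_coeff g ^ e * poly w x \<in> P"
        using r ideal_add[of "poly r x" "poly q x * poly g x"] gP ideal_mult by auto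
      then show False
        using prime_ideal power_notin gP(3) wP by blast
    qed
    moreover have "poly (smult (lead_coeff g ^ e) v) x * poly p x - poly r x \<in> P"
    proof -
      have "poly (smult (lead_coeff g ^ e) v) x * poly p x - poly r x
        = lead_coeff g ^ e * (poly v x * poly p x - poly w x) + poly q x * poly g x"
        by (simp add: r algebra_simps)
      then show ?thesis using v gP by (auto intro!: ideal_add ideal_mult)
    qed
    moreover have "poly_over (smult (lead_coeff g ^ e) v)"
      using v gP by (intro poly_over_smult power_mem poly_over_coeff)
    ultimately have "W r" using * by (auto simp: W_def)
    then show False using w(2) * not by fastforce
  qed
  have "degree w = 0"
  proof (rule ccontr)
    assume "degree w \<noteq> 0"
    then have w1: "degree w \<ge> 1" by simp
    obtain e q r where *: "poly_over q" "poly_over r" "smult (lead_coeff w ^ e) g = q * w + r"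
      "degree r < degree w" "degree q \<le> degree g - degree w"
      using pseudo_division[OF wS w1 gP(1)] by blast
    have r: "poly r x = lead_coeff w ^ e * poly g x - poly q x * poly w x"
      using arg_cong[OF *(3), of "\<lambda>f. poly f x"] by simp
    have "poly (- q * v) x * poly p x - poly r x =
      - poly q x * (poly v x * poly p x - poly w x) + - (lead_coeff w ^ e * poly g x)"
      by (simp add: r algebra_simps)
    also have "\<dots> \<in> P" using v gP by (blast intro: ideal_add ideal_mult ideal_uminus)
    \<comment> \<open>\<open>r\<close> is shorter than \<open>w\<close>, so \<open>W r\<close>
      fails. As \<open>r\<close> is over \<open>S\<close> and congruent to a multiple of
      \<open>p\<close>, it can only fail because the value of \<open>r\<close> lies in
      \<open>P\<close>.\<close>
    finally have "poly r x \<in> P"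
      using w(2)[of r] * v unfolding W_def
      by (meson linorder_not_less poly_over_mult poly_over_uminus)
    then have "poly q x * poly w x \<in> P"
      using r ideal_diff[of "lead_coeff w ^ e * poly g x" "poly r x"] gP ideal_mult by auto
    then have "poly q x \<in> P" using prime_ideal wP by blast
    then have q: "coeff q i \<in> P" for i
      using coeffs_in_ideal[of "degree g" q i] * g deg_lt w1 by (auto simp: min_relation_def)
    \<comment> \<open>Since \<open>degree r\<close> < \<open>degree w\<close> <
      \<open>degree g\<close>, the remainder does not reach the top coefficient.\<close>
    have "coeff (smult (lead_coeff w ^ e) g) (degree g) = coeff (q * w) (degree g)"
      using * deg_lt by (simp add: coeff_eq_0)
    also have "\<dots> \<in> P"
      unfolding coeff_mult by (auto intro!: ideal_sum ideal_mult' q)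
    finally show False using prime_ideal power_notin[OF lw] gP(3) by auto
  qed
  then obtain h where "w = [:h:]" by (metis degree_eq_zeroE)
  then show ?thesis
    using v wS wP poly_over_coeff[OF wS, of 0] by (intro exI[of _ v] exI[of _ h]) auto
qed

end

section \<open>Hilbert's basis theorem\<close>

context coeff_ring
begin

definition adjoin :: "'a \<Rightarrow> 'a set" where
  "adjoin x = {poly p x | p. poly_over p}"

lemma adjoinI: "poly_over p \<Longrightarrow> poly p x \<in> adjoin x"
  by (auto simp: adjoin_def)

lemma coeff_ring_adjoin: "coeff_ring (adjoin x)"
proof
  show "0 \<in> adjoin x" using adjoinI[of 0] by simp
  show "1 \<in> adjoin x" using adjoinI[of 1] by simp
next
  fix a b assume "a \<in> adjoin x" "b \<in> adjoin x"
  then obtain p q where "poly_over p" "a = poly p x" "poly_over q" "b = poly q x"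
    by (auto simp: adjoin_def)
  then show "a + b \<in> adjoin x" "a * b \<in> adjoin x"
    using adjoinI[of "p + q" x] adjoinI[of "p * q" x] by (auto simp: poly_over_add poly_over_mult)
next
  fix a assume "a \<in> adjoin x"
  then obtain p where "poly_over p" "a = poly p x" by (auto simp: adjoin_def)
  then show "- a \<in> adjoin x" using adjoinI[of "- p" x] by (auto simp: poly_over_uminus)
qed

end

text \<open>The coefficients come from a subset of the ring and not from a whole type. Adding one
  summand at a time provides the induction behind the facts that follow.\<close>

inductive_set span_over :: "'a::comm_ring_1 set \<Rightarrow> 'a set \<Rightarrow> 'a set" for S F where
  zero: "0 \<in> span_over S F"
| step: "a \<in> S \<Longrightarrow> f \<in> F \<Longrightarrow> y \<in> span_over S F \<Longrightarrow> a * f + y \<in> span_over S F"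

lemma span_over_add: "x \<in> span_over S F \<Longrightarrow> y \<in> span_over S F \<Longrightarrow> x + y \<in> span_over S F"
  by (induction rule: span_over.induct) (auto simp: add.assoc intro: span_over.step)

lemma span_over_mono:
  assumes "F \<subseteq> G" shows "span_over S F \<subseteq> span_over S G"
proof
  fix x assume "x \<in> span_over S F"
  then show "x \<in> span_over S G"
    by induction (use assms in \<open>auto intro: span_over.intros\<close>)
qed

lemma (in coeff_ring) span_over_mult:
  assumes "a \<in> S" "x \<in> span_over S F" shows "a * x \<in> span_over S F"
  using assms(2)
  by induction
    (auto simp: distrib_left mult.assoc[symmetric] intro!: span_over.intros mult_mem assms(1))

lemma (in coeff_ring) span_over_base: "f \<in> F \<Longrightarrow> f \<in> span_over S F"
  using span_over.step[OF one_mem _ span_over.zero, of f F] by simp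

lemma (in coeff_ring) span_over_diff:
  "x \<in> span_over S F \<Longrightarrow> y \<in> span_over S F \<Longrightarrow> x - y \<in> span_over S F"
  using span_over_add[of x S F "- 1 * y"] span_over_mult[OF uminus_mem[OF one_mem], of y F] by simp

lemma (in coeff_ring) span_over_trans:
  assumes "x \<in> span_over S F" "F \<subseteq> span_over S G" shows "x \<in> span_over S G"
  using assms(1) by induction (use assms(2) in \<open>auto intro: span_over.intros span_over_add span_over_mult\<close>)

lemma span_over_finite:
  assumes "x \<in> span_over S (\<Union>m. F m)" "mono (F :: nat \<Rightarrow> 'a::comm_ring_1 set)"
  shows "\<exists>m. x \<in> span_over S (F m)"
  using assms(1)
proof induction
  case zero
  then show ?case using span_over.zero by blast
next
  case (step a f y)
  then obtain m k where "f \<in> F m" "y \<in> span_over S (F k)" by blast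
  moreover have "F m \<subseteq> F (max m k)" "F k \<subseteq> F (max m k)"
    using assms(2) by (simp_all add: monoD)
  ultimately show ?case
    using step(1) span_over_mono[of "F k" "F (max m k)" S] by (blast intro: span_over.step)
qed

text \<open>Stated with sequences, the chain condition needs no notion of an ideal of the subring \<open>S\<close>.\<close>

definition noetherian_subring :: "'a::comm_ring_1 set \<Rightarrow> bool" where
  "noetherian_subring S \<longleftrightarrow>
     (\<forall>a :: nat \<Rightarrow> 'a. range a \<subseteq> S \<longrightarrow> (\<exists>m. a m \<in> span_over S (a ` {..<m})))"

text \<open>The classical argument by minimal degrees. Since \<open>x\<close> may satisfy relations
  over \<open>S\<close>, an element of \<open>adjoin x\<close> has no degree of its own: degrees are
  those of polynomials, while membership in a span is tested on their values at
  \<open>x\<close>.\<close>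

theorem (in coeff_ring) Hilbert_basis:
  assumes "noetherian_subring S"
  shows "noetherian_subring (adjoin x)"
  unfolding noetherian_subring_def
proof (intro allI impI, rule ccontr)
  interpret adj: coeff_ring "adjoin x" by (rule coeff_ring_adjoin)
  let ?sp = "span_over (adjoin x)"
  fix b :: "nat \<Rightarrow> 'a"
  assume b: "range b \<subseteq> adjoin x" and "\<nexists>m. b m \<in> ?sp (b ` {..<m})"
  then have nb: "b m \<notin> ?sp (b ` {..<m})" for m by blast
  define I where "I = {p. poly_over p \<and> poly p x \<in> ?sp (range b)}"
  \<comment> \<open>Finitely many elements of the span already lie in the span of an initial segment
    of \<open>b\<close>, and the next \<open>b M\<close> escapes it. Hence no finite family
    generates everything.\<close>
  have I_step: "\<exists>p\<in>I. poly p x \<notin> ?sp (F ` {..<m})" if F: "F ` {..<m} \<subseteq> ?sp (range b)" for F and m :: nat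
  proof -
    have "\<exists>M. F ` {..<m} \<subseteq> ?sp (b ` {..<M})"
      using F
    proof (induction m)
      case (Suc m)
      then obtain M where M: "F ` {..<m} \<subseteq> ?sp (b ` {..<M})" by (auto simp: lessThan_Suc)
      have "range b = (\<Union>k. b ` {..<k})" by auto
      moreover have "mono (\<lambda>k. b ` {..<k})" by (auto intro!: monoI)
      ultimately obtain K where K: "F m \<in> ?sp (b ` {..<K})"
        using Suc.prems span_over_finite[of "F m" "adjoin x" "\<lambda>k. b ` {..<k}"] by auto
      have "?sp (b ` {..<M}) \<subseteq> ?sp (b ` {..<max M K})" "?sp (b ` {..<K}) \<subseteq> ?sp (b ` {..<max M K})"
        by (intro span_over_mono; force)+
      then show ?case using M K by (intro exI[of _ "max M K"]) (auto simp: lessThan_Suc)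
    qed simp
    then obtain M where M: "F ` {..<m} \<subseteq> ?sp (b ` {..<M})" ..
    obtain p where "poly_over p" "b M = poly p x" using b by (auto simp: adjoin_def)
    moreover have "b M \<in> ?sp (range b)" by (intro adj.span_over_base) simp
    moreover have "b M \<notin> ?sp (F ` {..<m})"
      using nb adj.span_over_trans[OF _ M] by blast
    ultimately show ?thesis by (auto simp: I_def)
  qed
  \<comment> \<open>The \<open>i\<close>-th choice is to have least degree among the polynomials
    whose values are not generated by those of the earlier choices.\<close>
  define cand where "cand f i = {p \<in> I. poly p x \<notin> ?sp ((\<lambda>j. poly (f j) x) ` {..<i})}"
    for f and i :: nat
  have "\<exists>f. \<forall>i. f i \<in> cand f i \<and> (\<forall>p\<in>cand f i. degree (f i) \<le> degree p)"
  proof (rule dependent_wellorder_choice)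
    fix r f g and i :: nat assume "\<And>j. j < i \<Longrightarrow> f j = (g j :: 'a poly)"
    then have "cand f i = cand g i" unfolding cand_def by (metis (mono_tags, lifting) image_cong lessThan_iff)
    then show "(r \<in> cand f i \<and> (\<forall>p\<in>cand f i. degree r \<le> degree p)) =
      (r \<in> cand g i \<and> (\<forall>p\<in>cand g i. degree r \<le> degree p))" by simp
  next
    fix i :: nat and f :: "nat \<Rightarrow> 'a poly"
    assume *: "\<And>j. j < i \<Longrightarrow> f j \<in> cand f j \<and> (\<forall>p\<in>cand f j. degree (f j) \<le> degree p)"
    then have "(\<lambda>j. poly (f j) x) ` {..<i} \<subseteq> ?sp (range b)"
      by (auto simp: cand_def I_def)
    from I_step[OF this] have "\<exists>p. p \<in> cand f i" by (auto simp: cand_def)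
    then show "\<exists>r. r \<in> cand f i \<and> (\<forall>p\<in>cand f i. degree r \<le> degree p)"
      using exists_least_iff[of "\<lambda>d. \<exists>p. p \<in> cand f i \<and> degree p = d"]
      by (metis linorder_not_less)
  qed
  then obtain f where f: "\<And>i. f i \<in> cand f i" "\<And>i p. p \<in> cand f i \<Longrightarrow> degree (f i) \<le> degree p"
    by blast
  have fS: "poly_over (f i)" and fI: "poly (f i) x \<in> ?sp (range b)"
    and fn: "poly (f i) x \<notin> ?sp ((\<lambda>j. poly (f j) x) ` {..<i})" for i
    using f(1)[of i] by (auto simp: cand_def I_def)
  have deg: "degree (f i) \<le> degree (f j)" if "i \<le> j" for i j
  proof (rule f(2))
    have "?sp ((\<lambda>k. poly (f k) x) ` {..<i}) \<subseteq> ?sp ((\<lambda>k. poly (f k) x) ` {..<j})"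
      using that by (intro span_over_mono) auto
    then show "f j \<in> cand f i"
      using fS fI fn[of j] by (auto simp: cand_def I_def)
  qed
  have "range (\<lambda>i. lead_coeff (f i)) \<subseteq> S" using fS poly_over_coeff by blast
  then obtain m where m: "lead_coeff (f m) \<in> span_over S ((\<lambda>i. lead_coeff (f i)) ` {..<m})"
    using assms unfolding noetherian_subring_def by meson
  let ?G = "(\<lambda>j. poly (f j) x) ` {..<m}"
  \<comment> \<open>A combination of leading coefficients lifts to a combination of the earlier
    \<open>f i\<close>: as degrees do not decrease, monomials can shift all leading terms to
    \<open>degree (f m)\<close>.\<close>
  have "\<exists>g. poly_over g \<and> poly g x \<in> ?sp ?G \<and> degree g \<le> degree (f m) \<and> coeff g (degree (f m)) = y"
    if "y \<in> span_over S ((\<lambda>i. lead_coeff (f i)) ` {..<m})" for y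
    using that
  proof induction
    case zero
    show ?case by (intro exI[of _ 0]) (auto intro: span_over.zero)
  next
    case (step a l y)
    then obtain g i where g: "poly_over g" "poly g x \<in> ?sp ?G" "degree g \<le> degree (f m)"
      "coeff g (degree (f m)) = y" and i: "i < m" "l = lead_coeff (f i)" by auto
    define h where "h = monom a (degree (f m) - degree (f i)) * f i"
    have dfi: "degree (f i) \<le> degree (f m)" using deg i by simp
    have h: "poly_over h"
      using step(1) fS by (auto simp: h_def intro!: poly_over_mult poly_over_monom)
    have "poly h x = poly (monom a (degree (f m) - degree (f i))) x * poly (f i) x"
      by (simp add: h_def)
    also have "\<dots> \<in> ?sp ?G"
      using step(1) i by (intro adj.span_over_mult adjoinI poly_over_monom adj.span_over_base) auto
    finally have "poly h x \<in> ?sp ?G" .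
    moreover have "degree h \<le> degree (f m)"
      using degree_mult_le[of "monom a (degree (f m) - degree (f i))" "f i"]
        degree_monom_le[of a "degree (f m) - degree (f i)"] dfi by (simp add: h_def)
    moreover have "coeff h (degree (f m)) = a * l"
      using dfi i by (simp add: h_def coeff_monom_mult)
    ultimately show ?case using g h
      by (intro exI[of _ "h + g"]) (auto intro: poly_over_add span_over_add degree_add_le)
  qed
  from this[OF m] obtain g where g: "poly_over g" "poly g x \<in> ?sp ?G" "degree g \<le> degree (f m)"
    "coeff g (degree (f m)) = lead_coeff (f m)" by blast
  define p where "p = f m - g"
  have pn: "poly p x \<notin> ?sp ?G"
    using fn[of m] span_over_add[OF _ g(2), of "poly p x"] by (auto simp: p_def)
  have "?sp ?G \<subseteq> ?sp (range b)"
    using adj.span_over_trans[of _ ?G "range b"] fI by blast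
  then have "p \<in> cand f m"
    using pn fS[of m] fI[of m] g by (auto simp: cand_def I_def p_def intro: poly_over_diff adj.span_over_diff)
  \<comment> \<open>The leading terms of \<open>f m\<close> and \<open>g\<close> cancel in
    \<open>p\<close>, so minimality leaves only \<open>p = 0\<close>, whose value is trivially
    generated.\<close>
  then have "degree (f m) \<le> degree p" by (rule f(2))
  moreover have "degree p \<le> degree (f m)"
    using g(3) by (simp add: p_def degree_diff_le)
  ultimately have "lead_coeff p = 0" using g(4) by (simp add: p_def)
  then have "p = 0" by simp
  then show False using pn by (simp add: span_over.zero)
qed

section \<open>Ideals, radicals and saturation\<close>

interpretation idl: Modules.module "(*) :: 'a::comm_ring_1 \<Rightarrow> 'a \<Rightarrow> 'a"
  by (rule module_mult)

declare idl.scale_scale [simp del]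

lemma ideal_gen_induct [consumes 1, case_names zero step]:
  assumes "x \<in> ideal_gen F" "Q 0" "\<And>a f y. f \<in> F \<Longrightarrow> y \<in> ideal_gen F \<Longrightarrow> Q y \<Longrightarrow> Q (a * f + y)"
  shows "Q x"
proof -
  have "x \<in> idl.span F \<and> Q x"
    using assms(1)[unfolded ideal_gen_def]
    by (induction rule: idl.span_induct_alt)
      (use assms(2,3) in \<open>auto simp: ideal_gen_def intro: idl.span_zero idl.span_add idl.span_scale idl.span_base\<close>)
  then show ?thesis ..
qed

lemma subspace_ideal_gen: "idl.subspace (ideal_gen F)"
  by (simp add: ideal_gen_def)

lemma ideal_gen_base: "f \<in> F \<Longrightarrow> f \<in> ideal_gen F"
  by (simp add: ideal_gen_def idl.span_base)

lemma ideal_gen_subset: "F \<subseteq> I \<Longrightarrow> idl.subspace I \<Longrightarrow> ideal_gen F \<subseteq> I"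
  by (simp add: ideal_gen_def idl.span_minimal)

lemma noetherian_finitely_generated:
  assumes "noetherian_subring (UNIV :: 'a::comm_ring_1 set)" "idl.subspace (I :: 'a set)"
  shows "\<exists>F. finite F \<and> F \<subseteq> I \<and> ideal_gen F = I"
proof (rule ccontr)
  assume not: "\<not> ?thesis"
  have "\<exists>a. \<forall>i::nat. a i \<in> I \<and> a i \<notin> ideal_gen (a ` {..<i})"
  proof (rule dependent_wellorder_choice)
    fix r and f g :: "nat \<Rightarrow> 'a" and i :: nat assume "\<And>j. j < i \<Longrightarrow> f j = g j"
    then have "f ` {..<i} = g ` {..<i}" by (intro image_cong) auto
    then show "(r \<in> I \<and> r \<notin> ideal_gen (f ` {..<i})) = (r \<in> I \<and> r \<notin> ideal_gen (g ` {..<i}))"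
      by simp
  next
    fix i :: nat and f :: "nat \<Rightarrow> 'a"
    assume "\<And>j. j < i \<Longrightarrow> f j \<in> I \<and> f j \<notin> ideal_gen (f ` {..<j})"
    then have "f ` {..<i} \<subseteq> I" by auto
    moreover from this have "ideal_gen (f ` {..<i}) \<subseteq> I"
      using assms(2) by (rule ideal_gen_subset)
    moreover have "ideal_gen (f ` {..<i}) \<noteq> I"
      using not \<open>f ` {..<i} \<subseteq> I\<close> by (metis finite_imageI finite_lessThan)
    ultimately have "ideal_gen (f ` {..<i}) \<subset> I" by (rule_tac psubsetI)
    then show "\<exists>r. r \<in> I \<and> r \<notin> ideal_gen (f ` {..<i})" by blast
  qed
  then obtain a :: "nat \<Rightarrow> 'a" where a: "\<And>i. a i \<notin> ideal_gen (a ` {..<i})" by blast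
  obtain m where "a m \<in> span_over UNIV (a ` {..<m})"
    using assms(1) by (auto simp: noetherian_subring_def)
  moreover have "span_over UNIV F \<subseteq> ideal_gen F" for F :: "'a set"
  proof
    fix x assume "x \<in> span_over UNIV F"
    then show "x \<in> ideal_gen F"
      by induction (auto simp: ideal_gen_def intro: idl.span_zero idl.span_add idl.span_scale idl.span_base)
  qed
  ultimately show False using a by blast
qed

text \<open>An ideal maximal among those above \<open>I\<close> that miss all powers of
  \<open>f\<close> is prime: for \<open>a\<close> and \<open>b\<close> outside, adjoining either one
  captures a power of \<open>f\<close>, and the product of the two powers would lie in the ideal if
  \<open>a * b\<close> did.\<close>

lemma prime_avoiding_powers:
  assumes I: "idl.subspace I" and f: "\<And>k. f ^ k \<notin> I"
  shows "\<exists>P. prime_subset P \<and> I \<subseteq> P \<and> f \<notin> P"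
proof -
  let ?A = "{J. idl.subspace J \<and> I \<subseteq> J \<and> (\<forall>k. f ^ k \<notin> J)}"
  have "\<exists>M\<in>?A. \<forall>X\<in>?A. M \<subseteq> X \<longrightarrow> X = M"
  proof (rule subset_Zorn_nonempty)
    show "?A \<noteq> {}" using I f by blast
  next
    fix C assume C: "C \<noteq> {}" "subset.chain ?A C"
    then have CA: "C \<subseteq> ?A" and ch: "\<And>X Y. X \<in> C \<Longrightarrow> Y \<in> C \<Longrightarrow> X \<subseteq> Y \<or> Y \<subseteq> X"
      by (auto simp: subset_chain_def)
    have "idl.subspace (\<Union>C)"
      unfolding idl.subspace_def
    proof (intro conjI ballI allI)
      show "0 \<in> \<Union>C" using C CA by (auto simp: idl.subspace_def)
    next
      fix x y assume "x \<in> \<Union>C" "y \<in> \<Union>C"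
      then obtain X where "X \<in> C" "x \<in> X" "y \<in> X" using ch by blast
      then have "x + y \<in> X" using CA idl.subspace_add by blast
      then show "x + y \<in> \<Union>C" using \<open>X \<in> C\<close> by blast
    next
      fix c x assume "x \<in> \<Union>C"
      then show "c * x \<in> \<Union>C" using CA idl.subspace_scale by blast
    qed
    then show "\<Union>C \<in> ?A" using C CA by blast
  qed
  then obtain M where M: "idl.subspace M" "I \<subseteq> M" "\<And>k. f ^ k \<notin> M"
    and max: "\<And>X. idl.subspace X \<Longrightarrow> M \<subseteq> X \<Longrightarrow> (\<forall>k. f ^ k \<notin> X) \<Longrightarrow> X = M"
    by (smt (verit) mem_Collect_eq order_trans)
  have ext: "\<exists>k m r. m \<in> M \<and> f ^ k = m + r * a" if "a \<notin> M" for a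
  proof (rule ccontr)
    assume no: "\<not> ?thesis"
    let ?X = "{m + r * a | m r. m \<in> M}"
    have "idl.subspace ?X"
      unfolding idl.subspace_def
    proof (intro conjI ballI allI)
      show "0 \<in> ?X" using M(1) by (force simp: idl.subspace_def intro: exI[of _ 0])
    next
      fix x y assume "x \<in> ?X" "y \<in> ?X"
      then obtain m r m' r' where "m \<in> M" "m' \<in> M" "x = m + r * a" "y = m' + r' * a" by blast
      then have "m + m' \<in> M" "x + y = (m + m') + (r + r') * a"
        using M(1) by (auto simp: idl.subspace_def algebra_simps)
      then show "x + y \<in> ?X" by blast
    next
      fix c x assume "x \<in> ?X"
      then obtain m r where "m \<in> M" "x = m + r * a" by blast
      then have "c * m \<in> M" "c * x = c * m + (c * r) * a"
        using M(1) by (auto simp: idl.subspace_def algebra_simps)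
      then show "c * x \<in> ?X" by blast
    qed
    moreover have "M \<subseteq> ?X" by (force intro: exI[of _ 0])
    ultimately have "?X = M" using no by (intro max) blast+
    moreover have "a \<in> ?X" using M(1) by (force simp: idl.subspace_def intro: exI[of _ 0] exI[of _ 1])
    ultimately show False using that by blast
  qed
  have "prime_subset M"
  proof
    show "0 \<in> M" using M(1) by (simp add: idl.subspace_def)
    show "a + b \<in> M" if "a \<in> M" "b \<in> M" for a b using M(1) that by (simp add: idl.subspace_def)
    show "a * b \<in> M" if "b \<in> M" for a b using M(1) that by (simp add: idl.subspace_def)
    show "1 \<notin> M" using M(3)[of 0] by simp
    show "a \<in> M \<or> b \<in> M" if ab: "a * b \<in> M" for a b
    proof (rule ccontr)
      assume "\<not> (a \<in> M \<or> b \<in> M)"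
      then obtain k m r j n s where *: "m \<in> M" "f ^ k = m + r * a" "n \<in> M" "f ^ j = n + s * b"
        using ext by meson
      have "f ^ (k + j) = (n + s * b) * m + (r * a) * n + (r * s) * (a * b)"
        by (simp add: power_add * algebra_simps)
      also have "\<dots> \<in> M" using M(1) * ab by (simp add: idl.subspace_def)
      finally show False using M(3) by blast
    qed
  qed
  then show ?thesis using M(2) M(3)[of 1] by auto
qed

lemma power_count_list_dvd: "(g :: 'a::comm_ring_1) ^ count_list xs g dvd prod_list xs"
  by (induction xs) (auto intro: dvd_mult mult_dvd_mono)

text \<open>Reduces a power of an ideal to products of \<open>k\<close> generators, to which the
  pigeonhole principle applies in \<open>power_in_saturation\<close>. For \<open>k = 0\<close> the
  empty product generates the unit ideal.\<close>

lemma ideal_power_subset: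
  "ideal_power (ideal_gen F) k \<subseteq> ideal_gen {prod_list xs | xs. length xs = k \<and> set xs \<subseteq> F}"
proof (induction k)
  case 0
  have "1 \<in> ideal_gen {prod_list xs | xs. length xs = 0 \<and> set xs \<subseteq> F}"
    by (intro ideal_gen_base) auto
  then have "x * 1 \<in> ideal_gen {prod_list xs | xs. length xs = 0 \<and> set xs \<subseteq> F}" for x
    using subspace_ideal_gen unfolding idl.subspace_def by blast
  then show ?case by auto
next
  case (Suc k)
  let ?G = "\<lambda>k. ideal_gen {prod_list xs | xs. length xs = k \<and> set xs \<subseteq> F}"
  have sub: "idl.subspace (?G j)" for j by (rule subspace_ideal_gen)
  have base: "f * g \<in> ?G (Suc k)" if "f \<in> F" "g \<in> ?G k" for f g
    using that(2)
  proof (induction rule: ideal_gen_induct)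
    case zero
    then show ?case using sub by (simp add: idl.subspace_def)
  next
    case (step a g y)
    then obtain xs where "g = prod_list xs" "length xs = k" "set xs \<subseteq> F" by blast
    then have "f * g \<in> ?G (Suc k)"
      using that(1) by (intro ideal_gen_base CollectI exI[of _ "f # xs"]) auto
    moreover have "f * (a * g + y) = a * (f * g) + f * y" by (simp add: algebra_simps)
    ultimately show ?case
      using idl.subspace_add[OF sub idl.subspace_scale[OF sub] step(3)] by simp
  qed
  have "f * g \<in> ?G (Suc k)" if "f \<in> ideal_gen F" "g \<in> ?G k" for f g
    using that(1)
  proof (induction rule: ideal_gen_induct)
    case zero
    then show ?case using sub by (simp add: idl.subspace_def)
  next
    case (step a f y)
    have "(a * f + y) * g = a * (f * g) + y * g" by (simp add: algebra_simps)
    then show ?case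
      using idl.subspace_add[OF sub idl.subspace_scale[OF sub base[OF step(1) that(2)]] step(3)]
      by simp
  qed
  then show ?case
    using Suc unfolding ideal_power.simps ideal_prod_def by (intro ideal_gen_subset sub) auto
qed

text \<open>The Nullstellensatz gives each generator an exponent of its own, whereas membership in
  the saturation asks for one \<open>k\<close> that serves a whole power of the ideal. Pigeonhole
  provides \<open>k\<close>, and finite generation of that power provides the exponent of
  \<open>f\<close>.\<close>

lemma power_in_saturation:
  assumes noeth: "noetherian_subring (UNIV :: 'a::comm_ring_1 set)"
    and I: "idl.subspace (I :: 'a set)" and F: "finite F"
    and fF: "\<And>g. g \<in> F \<Longrightarrow> \<exists>N. (f * g) ^ N \<in> I"
  shows "\<exists>M. f ^ M \<in> saturation I (ideal_gen F)"
proof -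
  \<comment> \<open>The saturation of \<open>I\<close> by \<open>f\<close> alone. It contains a
    power of every generator.\<close>
  define K where "K = {g. \<exists>M. f ^ M * g \<in> I}"
  have K_mono: "f ^ M * g \<in> I" if "f ^ N * g \<in> I" "N \<le> M" for M N g
  proof -
    have "f ^ M * g = f ^ (M - N) * (f ^ N * g)"
      using that(2) by (simp add: mult.assoc[symmetric] power_add[symmetric])
    then show ?thesis using idl.subspace_scale[OF I that(1)] by simp
  qed
  have K: "idl.subspace K"
    unfolding idl.subspace_def
  proof (intro conjI ballI allI)
    show "0 \<in> K" using I by (auto simp: K_def idl.subspace_def)
  next
    fix x y assume "x \<in> K" "y \<in> K"
    then obtain M N where "f ^ M * x \<in> I" "f ^ N * y \<in> I" by (auto simp: K_def)
    then have "f ^ (max M N) * x \<in> I" "f ^ (max M N) * y \<in> I" by (auto intro: K_mono)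
    then show "x + y \<in> K" using I by (auto simp: K_def idl.subspace_def distrib_left intro!: exI[of _ "max M N"])
  next
    fix c x assume "x \<in> K"
    then obtain M where "f ^ M * x \<in> I" by (auto simp: K_def)
    then have "f ^ M * (c * x) \<in> I" using I by (metis idl.subspace_def mult.left_commute)
    then show "c * x \<in> K" by (auto simp: K_def)
  qed
  have "\<exists>N. \<forall>g\<in>F. g ^ N \<in> K"
  proof -
    obtain n where n: "\<And>g. g \<in> F \<Longrightarrow> (f * g) ^ n g \<in> I" using fF by metis
    have "g ^ (sum n F) \<in> K" if "g \<in> F" for g
    proof -
      have "g ^ n g \<in> K" using n[OF that] by (auto simp: K_def power_mult_distrib)
      moreover have "n g \<le> sum n F" using that F by (simp add: member_le_sum)
      then have "g ^ sum n F = g ^ (sum n F - n g) * g ^ n g" by (simp add: power_add[symmetric])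
      ultimately show ?thesis using K by (simp add: idl.subspace_def)
    qed
    then show ?thesis by blast
  qed
  then obtain N where N: "\<And>g. g \<in> F \<Longrightarrow> g ^ N \<in> K" by blast
  \<comment> \<open>Among more than \<open>card F * N\<close> factors from \<open>F\<close>, one
    occurs at least \<open>N\<close> times.\<close>
  define k where "k = Suc (card F * N)"
  have "prod_list xs \<in> K" if xs: "length xs = k" "set xs \<subseteq> F" for xs
  proof -
    have "\<exists>g\<in>F. N \<le> count_list xs g"
    proof (rule ccontr)
      assume "\<not> ?thesis"
      then have "\<And>g. g \<in> F \<Longrightarrow> count_list xs g \<le> N" by (meson nat_le_linear)
      then have "sum (count_list xs) F \<le> card F * N"
        using sum_bounded_above[of F "count_list xs" N] by simp
      then show False using sum_count_set[OF xs(2) F] xs(1) by (simp add: k_def)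
    qed
    then obtain g where g: "g \<in> F" "N \<le> count_list xs g" by blast
    then have "g ^ N dvd prod_list xs"
      using power_count_list_dvd le_imp_power_dvd dvd_trans by blast
    then obtain c where "prod_list xs = c * g ^ N" by (metis dvdE mult.commute)
    then show ?thesis using N[OF g(1)] K by (simp add: idl.subspace_def)
  qed
  then have PK: "ideal_power (ideal_gen F) k \<subseteq> K"
    using ideal_power_subset[of F k] ideal_gen_subset[OF _ K, of "{prod_list xs | xs. length xs = k \<and> set xs \<subseteq> F}"]
    by blast
  have "idl.subspace (ideal_power (ideal_gen F) k)"
    by (cases k) (auto simp: ideal_prod_def subspace_ideal_gen idl.subspace_UNIV)
  \<comment> \<open>Each element of \<open>K\<close> comes with its own exponent of
    \<open>f\<close>; finitely many generators make it uniform.\<close>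
  then obtain G where G: "finite G" "G \<subseteq> ideal_power (ideal_gen F) k"
    "ideal_gen G = ideal_power (ideal_gen F) k"
    using noetherian_finitely_generated[OF noeth] by blast
  then have "\<forall>h\<in>G. \<exists>M. f ^ M * h \<in> I" using PK by (auto simp: K_def)
  then obtain m where m: "\<And>h. h \<in> G \<Longrightarrow> f ^ m h * h \<in> I" by metis
  define M where "M = sum m G"
  have "f ^ M * h \<in> I" if "h \<in> ideal_gen G" for h
    using that
  proof (induction rule: ideal_gen_induct)
    case zero
    then show ?case using I by (simp add: idl.subspace_def)
  next
    case (step a h y)
    have "f ^ M * h \<in> I"
      using K_mono[OF m[OF step(1)], of M] step(1) G(1) by (simp add: M_def member_le_sum)
    moreover have "f ^ M * (a * h + y) = a * (f ^ M * h) + f ^ M * y" by (simp add: algebra_simps)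
    ultimately show ?case
      using idl.subspace_add[OF I idl.subspace_scale[OF I] step(3)] by simp
  qed
  then have "f ^ M \<in> saturation I (ideal_gen F)"
    using G(3) by (auto simp: saturation_def)
  then show ?thesis ..
qed

section \<open>Evaluation, derivatives and homogeneous components\<close>

lemma sum_singles: "(\<Sum>m\<in>Poly_Mapping.keys p. Poly_Mapping.single m (Poly_Mapping.lookup p m)) = p"
proof (rule poly_mapping_eqI)
  fix k
  show "Poly_Mapping.lookup (\<Sum>m\<in>Poly_Mapping.keys p. Poly_Mapping.single m (Poly_Mapping.lookup p m)) k
    = Poly_Mapping.lookup p k"
    by (cases "k \<in> Poly_Mapping.keys p")
      (auto simp: lookup_sum lookup_single when_def in_keys_iff)
qed

lemma mpoly_induct [case_names single add]:
  assumes "\<And>m a. Q (Poly_Mapping.single m a)" "\<And>p q. Q p \<Longrightarrow> Q q \<Longrightarrow> Q (p + q)"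
  shows "Q (p :: 'k \<Rightarrow>\<^sub>0 'a::comm_monoid_add)"
proof -
  have "Q (\<Sum>m\<in>K. Poly_Mapping.single m (Poly_Mapping.lookup p m))" if "finite K" for K
    using that
  proof (induction K rule: finite_induct)
    case empty
    show ?case using assms(1)[of _ 0] by simp
  qed (simp add: assms)
  then show ?thesis using sum_singles[of p] by (metis finite_keys)
qed

lemma mult_singles_hom:
  fixes F :: "('k::comm_monoid_add \<Rightarrow>\<^sub>0 'a::comm_semiring_1) \<Rightarrow> 'b::comm_semiring_1"
  assumes add: "\<And>p q. F (p + q) = F p + F q"
    and hom_single: "\<And>m a n b. F (Poly_Mapping.single (m + n) (a * b)) =
      F (Poly_Mapping.single m a) * F (Poly_Mapping.single n b)"
  shows "F (p * q) = F p * F q"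
proof (induction p rule: mpoly_induct)
  case (single m a)
  show ?case
    by (induction q rule: mpoly_induct) (simp_all add: mult_single hom_single add distrib_left)
qed (simp add: add distrib_right)

definition monom_val :: "('n::finite \<Rightarrow>\<^sub>0 nat) \<Rightarrow> 'a::comm_semiring_1 ^ 'n \<Rightarrow> 'a" where
  "monom_val m x = (\<Prod>i\<in>UNIV. (x $ i) ^ Poly_Mapping.lookup m i)"

lemma monom_val_add: "monom_val (m + n) x = monom_val m x * monom_val n x"
  by (simp add: monom_val_def lookup_add power_add prod.distrib)

lemma eval_poly_superset:
  assumes "finite K" "Poly_Mapping.keys p \<subseteq> K"
  shows "eval_poly p x = (\<Sum>m\<in>K. Poly_Mapping.lookup p m * monom_val m x)"
  unfolding eval_poly_def monom_val_def[symmetric]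
  by (rule sum.mono_neutral_left) (use assms in \<open>auto simp: in_keys_iff\<close>)

lemma eval_poly_single: "eval_poly (Poly_Mapping.single m a) x = a * monom_val m x"
  by (subst eval_poly_superset[of "{m}"]) auto

lemma eval_poly_add: "eval_poly (p + q) x = eval_poly p x + eval_poly q x"
proof -
  let ?K = "Poly_Mapping.keys p \<union> Poly_Mapping.keys q"
  have "Poly_Mapping.keys (p + q) \<subseteq> ?K" by (rule Poly_Mapping.keys_add)
  then show ?thesis
    by (simp add: eval_poly_superset[of ?K] lookup_add distrib_right sum.distrib)
qed

lemma monom_val_0 [simp]: "monom_val 0 x = 1"
  by (simp add: monom_val_def)

lemma eval_poly_mult: "eval_poly (p * q) x = eval_poly p x * eval_poly q x"
  by (rule mult_singles_hom)
    (simp_all add: eval_poly_add eval_poly_single monom_val_add ac_simps)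

lemma eval_poly_0 [simp]: "eval_poly 0 x = 0"
  by (simp add: eval_poly_def)

lemma eval_poly_1 [simp]: "eval_poly 1 x = 1"
  using eval_poly_single[of 0 1 x] by simp

interpretation eval_hom: comm_ring_hom "\<lambda>p. eval_poly p x" for x :: "'a::comm_ring_1 ^ 'n::finite"
  by unfold_locales (simp_all add: eval_poly_add eval_poly_mult)

lemma lookup_complexify: "Poly_Mapping.lookup (complexify p) m = of_real (Poly_Mapping.lookup p m)"
  by (simp add: complexify_def map.rep_eq when_def)

lemma keys_complexify: "Poly_Mapping.keys (complexify p) = Poly_Mapping.keys p"
  by (auto simp: in_keys_iff lookup_complexify)

lemma complexify_single: "complexify (Poly_Mapping.single m a) = Poly_Mapping.single m (of_real a)"
  by (rule poly_mapping_eqI) (simp add: lookup_complexify lookup_single when_def)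

lemma complexify_add: "complexify (p + q) = complexify p + complexify q"
  by (rule poly_mapping_eqI) (simp add: lookup_complexify lookup_add)

lemma complexify_mult: "complexify (p * q) = complexify p * complexify q"
  by (rule mult_singles_hom) (simp_all add: complexify_add complexify_single mult_single)

interpretation complexify_hom: comm_ring_hom "complexify :: ('n, real) mpoly \<Rightarrow> ('n, complex) mpoly"
proof unfold_locales
  show "complexify (0 :: ('n, real) mpoly) = 0"
    by (rule poly_mapping_eqI) (simp add: lookup_complexify)
  show "complexify (1 :: ('n, real) mpoly) = 1"
    using complexify_single[of "0 :: 'n \<Rightarrow>\<^sub>0 nat" 1] by simp
qed (simp_all add: complexify_add complexify_mult)

definition reval :: "('n::finite, real) mpoly \<Rightarrow> complex ^ 'n \<Rightarrow> complex" where
  "reval p x = eval_poly (complexify p) x"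

interpretation reval_hom: comm_ring_hom "\<lambda>p. reval p x" for x :: "complex ^ 'n::finite"
  by unfold_locales
    (simp_all add: reval_def complexify_add complexify_mult eval_poly_add eval_poly_mult)

lemma reval_single: "reval (Poly_Mapping.single m a) x = of_real a * monom_val m x"
  by (simp add: reval_def complexify_single eval_poly_single)

lemma partial_superset:
  assumes "finite K" "Poly_Mapping.keys p \<subseteq> K"
  shows "partial i p = (\<Sum>m\<in>K. Poly_Mapping.single (m - Poly_Mapping.single i 1)
          (of_nat (Poly_Mapping.lookup m i) * Poly_Mapping.lookup p m))"
  unfolding partial_def
  by (rule sum.mono_neutral_left) (use assms in \<open>auto simp: in_keys_iff\<close>)

lemma partial_single: "partial i (Poly_Mapping.single m a) =
  Poly_Mapping.single (m - Poly_Mapping.single i 1) (of_nat (Poly_Mapping.lookup m i) * a)"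
  by (subst partial_superset[of "{m}"]) auto

lemma partial_add: "partial i (p + q) = partial i p + partial i q"
proof -
  let ?K = "Poly_Mapping.keys p \<union> Poly_Mapping.keys q"
  have "Poly_Mapping.keys (p + q) \<subseteq> ?K" by (rule Poly_Mapping.keys_add)
  then show ?thesis
    by (simp add: partial_superset[of ?K] lookup_add distrib_left single_add sum.distrib)
qed

lemma partial_0 [simp]: "partial i 0 = 0"
  by (simp add: partial_def)

lemma partial_sum: "partial i (sum f A) = (\<Sum>a\<in>A. partial i (f a))"
  by (induction A rule: infinite_finite_induct) (simp_all add: partial_add)

lemma partial_mult_single:
  fixes a b :: "'a::comm_semiring_1" and m n :: "'n \<Rightarrow>\<^sub>0 nat"
  shows "partial i (Poly_Mapping.single (m + n) (a * b)) =
    partial i (Poly_Mapping.single m a) * Poly_Mapping.single n b +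
    Poly_Mapping.single m a * partial i (Poly_Mapping.single n b)"
proof -
  let ?e = "Poly_Mapping.single i (1::nat)"
  \<comment> \<open>Subtraction of exponents is truncated, so this fails when \<open>i\<close> does
    not occur in \<open>m\<close>. In that case the coefficient produced by the derivative is
    0.\<close>
  have shift: "m - ?e + n = m + n - ?e" if "Poly_Mapping.lookup m i \<noteq> 0" for m n :: "'n \<Rightarrow>\<^sub>0 nat"
    using that by (intro poly_mapping_eqI) (auto simp: lookup_add lookup_minus lookup_single when_def)
  have 1: "Poly_Mapping.single (m - ?e + n) (of_nat (Poly_Mapping.lookup m i) * a * b) =
    Poly_Mapping.single (m + n - ?e) (of_nat (Poly_Mapping.lookup m i) * a * b)"
    using shift[of m n] by (cases "Poly_Mapping.lookup m i = 0") auto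
  have 2: "Poly_Mapping.single (m + (n - ?e)) (of_nat (Poly_Mapping.lookup n i) * a * b) =
    Poly_Mapping.single (m + n - ?e) (of_nat (Poly_Mapping.lookup n i) * a * b)"
    using shift[of n m] by (cases "Poly_Mapping.lookup n i = 0") (auto simp: add.commute)
  show ?thesis
    using 1 2
    by (simp add: partial_single mult_single lookup_add distrib_left distrib_right single_add ac_simps)
qed

lemma partial_mult:
  fixes p q :: "('n, 'a::comm_semiring_1) mpoly"
  shows "partial i (p * q) = partial i p * q + p * partial i q"
proof (induction p rule: mpoly_induct)
  case (single m a)
  show ?case
  proof (induction q rule: mpoly_induct)
    case (single n b)
    show ?case by (simp only: mult_single partial_mult_single)
  qed (simp add: partial_add algebra_simps)
qed (simp add: partial_add algebra_simps)

lemma complexify_partial: "complexify (partial i p) = partial i (complexify p)"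
  by (induction p rule: mpoly_induct)
    (simp_all add: complexify_single partial_single partial_add complexify_add)

definition mdeg :: "('n::finite \<Rightarrow>\<^sub>0 nat) \<Rightarrow> nat" where
  "mdeg m = (\<Sum>i\<in>UNIV. Poly_Mapping.lookup m i)"

definition homog :: "nat \<Rightarrow> ('n::finite, 'a::zero) mpoly \<Rightarrow> bool" where
  "homog d p \<longleftrightarrow> (\<forall>m\<in>Poly_Mapping.keys p. mdeg m = d)"

lemma homogeneous_iff: "homogeneous p \<longleftrightarrow> (\<exists>d. homog d p)"
  by (simp add: homogeneous_def homog_def mdeg_def)

lemma monom_val_scale: "monom_val m (t *s x) = t ^ mdeg m * monom_val m x"
  by (simp add: monom_val_def mdeg_def power_mult_distrib prod.distrib power_sum)

lemma eval_homog: "homog d p \<Longrightarrow> eval_poly p (t *s x) = t ^ d * eval_poly p x"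
  by (simp add: eval_poly_superset[of "Poly_Mapping.keys p"] homog_def monom_val_scale sum_distrib_left
      ac_simps cong: sum.cong)

text \<open>The truncated \<open>d - 1\<close> does no harm for \<open>d = 0\<close>: the derivative
  is then 0, which is \<open>homog\<close> of every degree.\<close>

lemma homog_partial: "homog d p \<Longrightarrow> homog (d - 1) (partial i p)"
proof -
  assume p: "homog d p"
  have sub: "Poly_Mapping.keys (partial i p) \<subseteq> (\<Union>m\<in>Poly_Mapping.keys p. Poly_Mapping.keys
    (Poly_Mapping.single (m - Poly_Mapping.single i 1) (of_nat (Poly_Mapping.lookup m i) * Poly_Mapping.lookup p m)))"
    unfolding partial_def by (rule Poly_Mapping.keys_sum)
  have deg: "mdeg (m - Poly_Mapping.single i 1) = mdeg m - 1" if "Poly_Mapping.lookup m i \<noteq> 0" for m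
  proof -
    have "m = (m - Poly_Mapping.single i 1) + Poly_Mapping.single i 1"
      using that by (intro poly_mapping_eqI) (auto simp: lookup_add lookup_minus lookup_single when_def)
    then have "mdeg m = mdeg (m - Poly_Mapping.single i 1) + mdeg (Poly_Mapping.single i (1::nat))"
      by (metis (no_types, lifting) lookup_add mdeg_def sum.cong sum.distrib)
    moreover have "mdeg (Poly_Mapping.single i (1::nat)) = 1"
      by (simp add: mdeg_def lookup_single when_def)
    ultimately show ?thesis by simp
  qed
  show ?thesis
    unfolding homog_def
  proof (intro ballI)
    fix n assume "n \<in> Poly_Mapping.keys (partial i p)"
    with sub obtain m where "m \<in> Poly_Mapping.keys p" "Poly_Mapping.lookup m i \<noteq> 0"
      "n = m - Poly_Mapping.single i 1" by (force split: if_splits)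
    then show "mdeg n = d - 1" using deg p by (simp add: homog_def)
  qed
qed

definition hcomp :: "nat \<Rightarrow> ('n::finite, 'a::comm_monoid_add) mpoly \<Rightarrow> ('n, 'a) mpoly" where
  "hcomp d p = (\<Sum>m\<in>{m\<in>Poly_Mapping.keys p. mdeg m = d}. Poly_Mapping.single m (Poly_Mapping.lookup p m))"

lemma homog_hcomp: "homog d (hcomp d p)"
proof -
  have "Poly_Mapping.keys (hcomp d p) \<subseteq> (\<Union>m\<in>{m\<in>Poly_Mapping.keys p. mdeg m = d}.
    Poly_Mapping.keys (Poly_Mapping.single m (Poly_Mapping.lookup p m)))"
    unfolding hcomp_def by (rule Poly_Mapping.keys_sum)
  then show ?thesis by (auto simp: homog_def split: if_splits)
qed

lemma lookup_hcomp: "Poly_Mapping.lookup (hcomp d p) m = (if mdeg m = d then Poly_Mapping.lookup p m else 0)"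
  by (auto simp: hcomp_def lookup_sum lookup_single when_def in_keys_iff sum.If_cases)

lemma sum_hcomp: "\<exists>D. (\<Sum>d\<le>D. hcomp d p) = p"
proof
  \<comment> \<open>For \<open>p = 0\<close> this is the unspecified \<open>Max {}\<close>, but then
    all components are 0 and any bound works.\<close>
  let ?D = "Max (mdeg ` Poly_Mapping.keys p)"
  show "(\<Sum>d\<le>?D. hcomp d p) = p"
  proof (rule poly_mapping_eqI)
    fix m
    show "Poly_Mapping.lookup (\<Sum>d\<le>?D. hcomp d p) m = Poly_Mapping.lookup p m"
      by (cases "m \<in> Poly_Mapping.keys p") (auto simp: lookup_sum lookup_hcomp in_keys_iff)
  qed
qed

lemma complexify_hcomp: "complexify (hcomp d p) = hcomp d (complexify p)"
  by (rule poly_mapping_eqI) (simp add: lookup_hcomp lookup_complexify)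

lemma homog_complexify: "homog d (complexify p) \<longleftrightarrow> homog d p"
  by (simp add: homog_def keys_complexify)

text \<open>Along the line through \<open>x\<close>, the values of the components are the
  coefficients of a polynomial in \<open>t\<close> with infinitely many zeros. This is what makes
  the ideal of a set of lines homogeneous.\<close>

lemma hcomp_vanishes:
  fixes p :: "('n::finite, complex) mpoly"
  assumes "\<And>t. t \<noteq> 0 \<Longrightarrow> eval_poly p (t *s x) = 0"
  shows "eval_poly (hcomp d p) x = 0"
proof (rule ccontr)
  assume nz: "eval_poly (hcomp d p) x \<noteq> 0"
  obtain D where D: "(\<Sum>d\<le>D. hcomp d p) = p" using sum_hcomp by blast
  have "d \<le> D"
  proof (rule ccontr)
    assume "\<not> d \<le> D"
    have "Poly_Mapping.lookup p m = 0" if "mdeg m = d" for m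
      using D \<open>\<not> d \<le> D\<close> that lookup_sum[of "\<lambda>d. hcomp d p" "{..D}" m]
      by (simp add: lookup_hcomp)
    then have "hcomp d p = 0" by (intro poly_mapping_eqI) (simp add: lookup_hcomp)
    then show False using nz by simp
  qed
  then have fin: "finite {z. (\<Sum>i\<le>D. eval_poly (hcomp i p) x * z ^ i) = 0}"
    using nz by (subst polyfun_finite_roots) blast
  have ev: "eval_poly p (t *s x) = (\<Sum>i\<le>D. eval_poly (hcomp i p) x * t ^ i)" for t
    by (subst D[symmetric])
      (simp add: eval_hom.hom_sum eval_homog[OF homog_hcomp] mult.commute)
  have "- {0} \<subseteq> {z. (\<Sum>i\<le>D. eval_poly (hcomp i p) x * z ^ i) = 0}"
    using assms by (auto simp: ev)
  then have "finite (- {0 :: complex})" using fin finite_subset by blast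
  then show False by (simp add: infinite_UNIV_char_0 finite_compl)
qed

section \<open>Polynomials in a subset of the variables\<close>

definition pvar :: "'n \<Rightarrow> ('n, 'a::zero_neq_one) mpoly" where
  "pvar i = Poly_Mapping.single (Poly_Mapping.single i 1) 1"

lemma monom_val_single: "monom_val (Poly_Mapping.single i k) x = (x $ i) ^ k"
proof -
  have "monom_val (Poly_Mapping.single i k) x = (\<Prod>j\<in>UNIV. if j = i then (x $ i) ^ k else 1)"
    unfolding monom_val_def by (rule prod.cong) (auto simp: lookup_single when_def)
  then show ?thesis by simp
qed

lemma eval_pvar [simp]: "eval_poly (pvar i) x = x $ i"
  by (simp add: pvar_def eval_poly_single monom_val_single)

lemma reval_pvar [simp]: "reval (pvar i) x = x $ i"
  by (simp add: pvar_def reval_single monom_val_single)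

definition polys_in :: "'n set \<Rightarrow> ('n, 'a::zero) mpoly set" where
  "polys_in A = {p. \<forall>m\<in>Poly_Mapping.keys p. Poly_Mapping.keys m \<subseteq> A}"

lemma single_in_polys_in: "Poly_Mapping.keys m \<subseteq> A \<Longrightarrow> Poly_Mapping.single m a \<in> polys_in A"
  by (auto simp: polys_in_def split: if_splits)

lemma polys_in_add: "p \<in> polys_in A \<Longrightarrow> q \<in> polys_in A \<Longrightarrow> p + q \<in> polys_in A"
  using Poly_Mapping.keys_add[of p q] by (auto simp: polys_in_def)

interpretation polys_in: coeff_ring "polys_in A :: ('n, 'a::comm_ring_1) mpoly set" for A
proof
  show "(0 :: ('n, 'a) mpoly) \<in> polys_in A" by (simp add: polys_in_def)
  show "(1 :: ('n, 'a) mpoly) \<in> polys_in A"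
    using single_in_polys_in[of 0 A "1::'a"] by simp
next
  fix p q :: "('n, 'a) mpoly" assume p: "p \<in> polys_in A" and q: "q \<in> polys_in A"
  show "p + q \<in> polys_in A" using p q by (rule polys_in_add)
  show "p * q \<in> polys_in A"
    unfolding polys_in_def
  proof (intro CollectI ballI)
    fix k assume "k \<in> Poly_Mapping.keys (p * q)"
    then obtain m n where "k = m + n" "m \<in> Poly_Mapping.keys p" "n \<in> Poly_Mapping.keys q"
      using Poly_Mapping.keys_mult[of p q] by blast
    then show "Poly_Mapping.keys k \<subseteq> A"
      using p q Poly_Mapping.keys_add[of m n] unfolding polys_in_def by blast
  qed
next
  fix p :: "('n, 'a) mpoly" assume "p \<in> polys_in A"
  then show "- p \<in> polys_in A" by (simp add: polys_in_def Poly_Mapping.in_keys_iff)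
qed

lemma polys_in_mono: "A \<subseteq> B \<Longrightarrow> polys_in A \<subseteq> polys_in B"
  by (auto simp: polys_in_def)

lemma polys_in_UNIV [simp]: "polys_in UNIV = UNIV"
  by (simp add: polys_in_def)

lemma pvar_in_polys_in: "i \<in> A \<Longrightarrow> pvar i \<in> polys_in A"
  by (auto simp: pvar_def intro!: single_in_polys_in)

lemma polys_in_empty: "p \<in> polys_in {} \<Longrightarrow> \<exists>a. p = Poly_Mapping.single 0 a"
proof
  assume "p \<in> polys_in {}"
  then have "Poly_Mapping.keys p \<subseteq> {0}" by (auto simp: polys_in_def)
  then show "p = Poly_Mapping.single 0 (Poly_Mapping.lookup p 0)"
    by (intro poly_mapping_eqI) (auto simp: lookup_single when_def in_keys_iff)
qed

lemma pvar_power: "(pvar i :: ('n, 'a::comm_ring_1) mpoly) ^ k = Poly_Mapping.single (Poly_Mapping.single i k) 1"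
proof (induction k)
  case (Suc k)
  have "Poly_Mapping.single i 1 + Poly_Mapping.single i k = Poly_Mapping.single i (Suc k)"
    by (simp add: single_add[symmetric])
  moreover have "(pvar i :: ('n, 'a) mpoly) ^ Suc k = pvar i * Poly_Mapping.single (Poly_Mapping.single i k) 1"
    by (simp add: Suc)
  ultimately show ?case by (simp add: pvar_def mult_single)
qed simp

text \<open>Presents polynomials in one more variable as values of univariate polynomials, the form
  in which \<open>prime_extension\<close> and \<open>Hilbert_basis\<close> are stated.\<close>

lemma polys_in_insert:
  "polys_in (insert i A) = polys_in.adjoin A (pvar i :: ('n, 'a::comm_ring_1) mpoly)"
proof
  interpret adj: coeff_ring "polys_in.adjoin A (pvar i :: ('n, 'a) mpoly)"
    by (rule polys_in.coeff_ring_adjoin)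
  show "polys_in (insert i A) \<subseteq> polys_in.adjoin A (pvar i :: ('n, 'a) mpoly)"
  proof
    fix p :: "('n, 'a) mpoly" assume p: "p \<in> polys_in (insert i A)"
    have "Poly_Mapping.single m (Poly_Mapping.lookup p m) \<in> polys_in.adjoin A (pvar i)"
      if m: "m \<in> Poly_Mapping.keys p" for m
    proof -
      define k where "k = Poly_Mapping.lookup m i"
      define n where "n = m - Poly_Mapping.single i k"
      have "m = n + Poly_Mapping.single i k"
        by (intro poly_mapping_eqI) (auto simp: n_def k_def lookup_add lookup_minus lookup_single when_def)
      then have single_eq: "Poly_Mapping.single m (Poly_Mapping.lookup p m) =
        poly (monom (Poly_Mapping.single n (Poly_Mapping.lookup p m)) k) (pvar i)"
        by (simp add: poly_monom pvar_power mult_single)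
      have "Poly_Mapping.keys m \<subseteq> insert i A" using p m by (auto simp: polys_in_def)
      moreover have "Poly_Mapping.keys n \<subseteq> Poly_Mapping.keys m - {i}"
        by (auto simp: n_def k_def in_keys_iff lookup_minus lookup_single when_def split: if_splits)
      ultimately have "Poly_Mapping.keys n \<subseteq> A" by blast
      then have "Poly_Mapping.single n (Poly_Mapping.lookup p m) \<in> polys_in A"
        by (rule single_in_polys_in)
      then show ?thesis
        unfolding single_eq by (auto intro!: polys_in.adjoinI polys_in.poly_over_monom)
    qed
    then show "p \<in> polys_in.adjoin A (pvar i)"
      using adj.sum_mem[of "Poly_Mapping.keys p" "\<lambda>m. Poly_Mapping.single m (Poly_Mapping.lookup p m)"]
      by (simp add: sum_singles)
  qed
  have sub: "polys_in A \<subseteq> (polys_in (insert i A) :: ('n, 'a) mpoly set)" by (intro polys_in_mono) auto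
  show "polys_in.adjoin A (pvar i :: ('n, 'a) mpoly) \<subseteq> polys_in (insert i A)"
    unfolding polys_in.adjoin_def polys_in.poly_over_def poly_altdef
    using sub by (auto intro!: polys_in.sum_mem polys_in.mult_mem polys_in.power_mem pvar_in_polys_in)
qed

lemma monom_val_cong:
  assumes "Poly_Mapping.keys m \<subseteq> A" "\<And>i. i \<in> A \<Longrightarrow> x $ i = y $ i"
  shows "monom_val m x = monom_val m y"
  unfolding monom_val_def
proof (rule prod.cong)
  fix i
  show "x $ i ^ Poly_Mapping.lookup m i = y $ i ^ Poly_Mapping.lookup m i"
  proof (cases "i \<in> Poly_Mapping.keys m")
    case True
    then have "x $ i = y $ i" using assms by blast
    then show ?thesis by simp
  qed (simp add: in_keys_iff)
qed simp

lemma reval_cong: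
  assumes "p \<in> polys_in A" "\<And>i. i \<in> A \<Longrightarrow> x $ i = y $ i"
  shows "reval p x = reval p y"
proof -
  have "monom_val m x = monom_val m y" if "m \<in> Poly_Mapping.keys p" for m
    using assms that by (intro monom_val_cong[of m A]) (auto simp: polys_in_def)
  then show ?thesis
    unfolding reval_def eval_poly_superset[of "Poly_Mapping.keys p" "complexify p", OF finite_keys, unfolded keys_complexify, OF order_refl]
    by simp
qed

lemma noetherian_polys_in:
  assumes "finite A" shows "noetherian_subring (polys_in A :: ('n, 'a::field) mpoly set)"
  using assms
proof (induction A rule: finite_induct)
  case empty
  show ?case
    unfolding noetherian_subring_def
  proof (intro allI impI)
    fix a :: "nat \<Rightarrow> ('n, 'a) mpoly" assume a: "range a \<subseteq> polys_in {}"
    \<comment> \<open>The constants form a field, so the sequence stops at once: either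
      \<open>a 0 = 0\<close> lies in the span of the empty set, or \<open>a 1\<close> is a multiple
      of \<open>a 0\<close>.\<close>
    show "\<exists>m. a m \<in> span_over (polys_in {}) (a ` {..<m})"
    proof (cases "a 0 = 0")
      case True
      then show ?thesis by (metis span_over.zero)
    next
      case False
      obtain u v where uv: "a 0 = Poly_Mapping.single 0 u" "a 1 = Poly_Mapping.single 0 v"
        using a polys_in_empty by (metis UNIV_I image_subset_iff)
      then have "a 1 = Poly_Mapping.single 0 (v / u) * a 0"
        using False by (auto simp: mult_single)
      moreover have "Poly_Mapping.single 0 (v / u) * a 0 \<in> span_over (polys_in {}) (a ` {..<1})"
        by (intro polys_in.span_over_mult polys_in.span_over_base single_in_polys_in) auto
      ultimately show ?thesis by metis
    qed
  qed
next
  case (insert i A)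
  then show ?case
    unfolding polys_in_insert by (intro polys_in.Hilbert_basis)
qed

lemma noetherian_mpoly: "noetherian_subring (UNIV :: ('n::finite, 'a::field) mpoly set)"
  using noetherian_polys_in[of "UNIV :: 'n set", where 'a = 'a] by simp

section \<open>Complex conjugation and real coefficients\<close>

definition cnjv :: "complex ^ 'n \<Rightarrow> complex ^ 'n" where
  "cnjv x = (\<chi> i. cnj (x $ i))"

lemma reval_cnjv: "reval p (cnjv x) = cnj (reval p x)"
proof (induction p rule: mpoly_induct)
  case (single m a)
  show ?case by (simp add: reval_single monom_val_def cnjv_def)
next
  case (add p q)
  then show ?case by (simp add: reval_hom.hom_add)
qed

text \<open>\<open>Re\<close> and \<open>Im\<close> act on the coefficients. At a complex
  \<open>x\<close> the two summands are in general not the real and the imaginary part of the value,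
  so their separate vanishing has to be won by conjugation.\<close>

lemma eval_real_imag:
  "eval_poly p x = reval (Poly_Mapping.map Re p) x + \<i> * reval (Poly_Mapping.map Im p) x"
proof -
  have "p = complexify (Poly_Mapping.map Re p) + Poly_Mapping.single 0 \<i> * complexify (Poly_Mapping.map Im p)"
  proof (rule poly_mapping_eqI)
    fix m
    have map: "Poly_Mapping.lookup (Poly_Mapping.map f p) m = f (Poly_Mapping.lookup p m)" if "f 0 = 0" for f :: "complex \<Rightarrow> real"
      using that by (simp add: map.rep_eq when_def)
    have "Poly_Mapping.lookup (Poly_Mapping.single 0 \<i> * complexify (Poly_Mapping.map Im p)) m
      = \<i> * Im (Poly_Mapping.lookup p m)"
      unfolding mult_map_scale_conv_mult[symmetric]
      by (simp add: map.rep_eq when_def lookup_complexify)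
    then show "Poly_Mapping.lookup p m = Poly_Mapping.lookup
      (complexify (Poly_Mapping.map Re p) + Poly_Mapping.single 0 \<i> * complexify (Poly_Mapping.map Im p)) m"
      by (simp add: lookup_add lookup_complexify map complex_eq[symmetric])
  qed
  then show ?thesis
    unfolding reval_def
    by (metis eval_poly_add eval_poly_mult eval_poly_single monom_val_0 mult.right_neutral)
qed

section \<open>Zeros of prime ideals\<close>

lemma reval_poly: "reval (poly q (pvar i)) y = poly (map_poly (\<lambda>c. reval c y) q) (y $ i)"
  by (induction q) (auto simp: map_poly_pCons reval_hom.hom_add reval_hom.hom_mult)

text \<open>The coordinates are chosen one by one. A point that kills \<open>P\<close> in the
  variables \<open>A\<close> extends to the variable \<open>i\<close> provided that the right
  element outside \<open>P\<close> was kept nonzero beforehand, which is why \<open>h\<close> varies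
  in the induction.\<close>

lemma prime_zero_exists:
  fixes P :: "('n::finite, real) mpoly set"
  assumes P: "prime_subset P" and A: "finite A"
    and h: "h \<in> polys_in A" "h \<notin> P"
  shows "\<exists>x. (\<forall>f\<in>polys_in A \<inter> P. reval f x = 0) \<and> reval h x \<noteq> 0"
  using A h
proof (induction A arbitrary: h rule: finite_induct)
  interpret prime_subset P by (rule P)
  case empty
  have const: "f = 0" if f: "f \<in> polys_in {}" "f \<in> P" for f
  proof (rule ccontr)
    assume "f \<noteq> 0"
    moreover obtain a where a: "f = Poly_Mapping.single 0 a" using f polys_in_empty by blast
    ultimately have "Poly_Mapping.single 0 (1 / a) * f = 1"
      by (auto simp: mult_single)
    then show False using ideal_mult[OF f(2)] one_notin by metis
  qed
  obtain a where a: "h = Poly_Mapping.single 0 a" using empty polys_in_empty by blast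
  then have "a \<noteq> 0" using empty ideal_zero by auto
  then show ?case
    using a by (intro exI[of _ 0]) (auto simp: reval_single dest!: const)
next
  interpret prime_subset P by (rule P)
  case (insert i A)
  interpret E: prime_extension "polys_in A" P "pvar i" ..
  define up where "up x t = (\<chi> j. if j = i then t else x $ j)" for x :: "complex ^ 'n" and t
  have up: "reval (poly q (pvar i)) (up x t) = poly (map_poly (\<lambda>c. reval c x) q) t"
    if "polys_in.poly_over A q" for q x t
  proof -
    have "reval c (up x t) = reval c x" if "c \<in> polys_in A" for c
      using insert(2) that by (intro reval_cong[of c A]) (auto simp: up_def)
    then have "map_poly (\<lambda>c. reval c (up x t)) q = map_poly (\<lambda>c. reval c x) q"
      using that by (intro poly_eqI) (simp add: coeff_map_poly polys_in.poly_over_def)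
    then show ?thesis by (simp add: reval_poly up_def)
  qed
  have up_const: "reval c (up x t) = reval c x" if "c \<in> polys_in A" for c x t
    using insert(2) that by (intro reval_cong[of c A]) (auto simp: up_def)
  have rep: "\<exists>q. polys_in.poly_over A q \<and> f = poly q (pvar i)" if "f \<in> polys_in (insert i A)"
    for f :: "('n, real) mpoly"
    using that unfolding polys_in_insert polys_in.adjoin_def by blast
  obtain p where p: "polys_in.poly_over A p" "h = poly p (pvar i)" using rep insert.prems by blast
  have vanish: "reval (poly r (pvar i)) (up x t) = 0"
    if "\<And>k. coeff r k \<in> polys_in A \<inter> P" and "\<forall>f\<in>polys_in A \<inter> P. reval f x = 0" for r x t
  proof -
    have "map_poly (\<lambda>c. reval c x) r = 0"
      using that by (intro poly_eqI) (simp add: coeff_map_poly)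
    then show ?thesis using that(1) by (subst up) (auto simp: polys_in.poly_over_def)
  qed
  show ?case
  proof (cases "\<exists>q. E.relation q")
    \<comment> \<open>The variable is transcendental modulo \<open>P\<close>. Members of
      \<open>P\<close> have all their coefficients in \<open>P\<close> and vanish for every
      \<open>t\<close>, so \<open>t\<close> has only to avoid the finitely many roots of the
      specialised \<open>p\<close>.\<close>
    case False
    have "\<exists>k. coeff p k \<notin> P"
      using insert.prems p poly_in_ideal[of p "pvar i"] by blast
    then obtain k where k: "coeff p k \<notin> P" ..
    obtain x where x: "\<forall>f\<in>polys_in A \<inter> P. reval f x = 0" "reval (coeff p k) x \<noteq> 0"
      using insert.IH[OF _ k] p polys_in.poly_over_coeff by blast
    let ?p = "map_poly (\<lambda>c. reval c x) p"
    have "coeff ?p k \<noteq> 0" using x(2) by (simp add: coeff_map_poly)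
    then have "?p \<noteq> 0" by auto
    then obtain t where t: "poly ?p t \<noteq> 0"
      using poly_roots_finite[of ?p] ex_new_if_finite[OF infinite_UNIV_char_0, of "{t. poly ?p t = 0}"]
      by auto
    have "reval f (up x t) = 0" if f: "f \<in> polys_in (insert i A)" "f \<in> P" for f
    proof -
      obtain q where q: "polys_in.poly_over A q" "f = poly q (pvar i)" using rep f by blast
      then have "coeff q k \<in> P" for k
        using E.coeffs_in_ideal_transcendental[of q k] False f(2) by blast
      then show ?thesis
        using vanish[of q x t] x(1) q polys_in.poly_over_coeff by blast
    qed
    moreover have "reval h (up x t) \<noteq> 0" using t p by (simp add: up)
    ultimately show ?thesis by blast
  next
    case True
    then obtain g where g: "E.min_relation g" using E.min_relation_exists by blast
    then have g': "polys_in.poly_over A g" "poly g (pvar i) \<in> P" "lead_coeff g \<notin> P"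
      by (auto simp: E.min_relation_def E.relation_def)
    obtain v h' where v: "polys_in.poly_over A v" "h' \<in> polys_in A" "h' \<notin> P"
      "poly v (pvar i) * h - h' \<in> P"
      using E.elimination[OF g p(1)] insert.prems(2) p(2) by blast
    \<comment> \<open>If \<open>lead_coeff g\<close> does not vanish, the specialised
      \<open>g\<close> keeps its positive degree, so it has a root \<open>t\<close>, and powers of
      \<open>lead_coeff g\<close> can be cancelled. If \<open>h'\<close> does not vanish, neither
      does \<open>h\<close>, of which it is a multiple modulo \<open>P\<close>.\<close>
    have "lead_coeff g * h' \<notin> P" using v(3) g'(3) prime_ideal by blast
    moreover have "lead_coeff g * h' \<in> polys_in A"
      using v(2) g'(1) by (intro polys_in.mult_mem polys_in.poly_over_coeff)
    ultimately obtain x where x': "\<forall>f\<in>polys_in A \<inter> P. reval f x = 0" "reval (lead_coeff g * h') x \<noteq> 0"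
      using insert.IH[of "lead_coeff g * h'"] by blast
    then have x: "\<forall>f\<in>polys_in A \<inter> P. reval f x = 0" "reval (lead_coeff g) x \<noteq> 0" "reval h' x \<noteq> 0"
      by (simp_all add: reval_hom.hom_mult)
    let ?g = "map_poly (\<lambda>c. reval c x) g"
    have "degree g \<le> degree ?g"
      using x(2) by (intro le_degree) (simp add: coeff_map_poly)
    then have "degree ?g \<noteq> 0" using E.min_relation_degree[OF g] by simp
    then obtain t where t: "poly ?g t = 0"
      using fundamental_theorem_of_algebra[of ?g] by (auto simp: constant_degree)
    have zero: "reval f (up x t) = 0" if f: "f \<in> polys_in (insert i A)" "f \<in> P" for f
    proof -
      obtain q where q: "polys_in.poly_over A q" "f = poly q (pvar i)" using rep f by blast
      then obtain e s r where *: "polys_in.poly_over A s" "\<And>k. coeff r k \<in> polys_in A \<inter> P"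
        "smult (lead_coeff g ^ e) q = s * g + r"
        using E.min_relation_reduce[OF g, of q] f(2) by blast
      have "lead_coeff g ^ e * f = poly s (pvar i) * poly g (pvar i) + poly r (pvar i)"
        using arg_cong[OF *(3), of "\<lambda>f. poly f (pvar i)"] q(2) by simp
      then have "reval (lead_coeff g) (up x t) ^ e * reval f (up x t) =
        reval (poly s (pvar i)) (up x t) * reval (poly g (pvar i)) (up x t) + reval (poly r (pvar i)) (up x t)"
        by (metis reval_hom.hom_add reval_hom.hom_mult reval_hom.hom_power)
      moreover have "reval (poly g (pvar i)) (up x t) = 0" using t g' by (simp add: up)
      moreover have "reval (poly r (pvar i)) (up x t) = 0" using *(2) x(1) by (rule vanish)
      moreover have "reval (lead_coeff g) (up x t) \<noteq> 0"
        using x(2) g' up_const polys_in.poly_over_coeff by metis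
      ultimately show ?thesis by simp
    qed
    moreover have "reval h (up x t) \<noteq> 0"
    proof -
      have "h' \<in> polys_in (insert i A)" using v(2) polys_in_mono[of A "insert i A"] by blast
      then have "poly v (pvar i) * h - h' \<in> polys_in (insert i A)"
        using v insert.prems
        by (intro polys_in.diff_mem polys_in.mult_mem)
          (auto simp: polys_in_insert intro: polys_in.adjoinI)
      then have "reval (poly v (pvar i)) (up x t) * reval h (up x t) = reval h' (up x t)"
        using zero v(4) by (metis eq_iff_diff_eq_0 reval_hom.hom_minus reval_hom.hom_mult)
      then show ?thesis using x(3) v(2) up_const by (metis mult_zero_right)
    qed
    ultimately show ?thesis by blast
  qed
qed

text \<open>If no power of \<open>f\<close> were in \<open>I\<close>, some prime ideal above
  \<open>I\<close> would miss \<open>f\<close> and have a zero off the zeros of \<open>f\<close>.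
  The coefficients are real but the zeros complex, since the specialised relations need
  roots.\<close>

theorem real_Nullstellensatz:
  fixes I :: "('n::finite, real) mpoly set"
  assumes I: "idl.subspace I"
    and f: "\<And>x. (\<And>g. g \<in> I \<Longrightarrow> reval g x = 0) \<Longrightarrow> reval f x = 0"
  shows "\<exists>N. f ^ N \<in> I"
proof (rule ccontr)
  assume "\<not> ?thesis"
  then obtain P where P: "prime_subset P" "I \<subseteq> P" "f \<notin> P"
    using prime_avoiding_powers[OF I] by blast
  have "\<exists>x. (\<forall>g\<in>polys_in UNIV \<inter> P. reval g x = 0) \<and> reval f x \<noteq> 0"
    by (rule prime_zero_exists) (use P in auto)
  then show False using P(2) f by auto
qed

section \<open>Algebraic independence modulo a prime ideal\<close>

definition indep_mod :: "'n set \<Rightarrow> ('n, 'a::zero) mpoly set \<Rightarrow> bool" where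
  "indep_mod B P \<longleftrightarrow> polys_in B \<inter> P \<subseteq> {0}"

text \<open>If no variable could be added, all variables would be algebraic over those in
  \<open>B\<close> modulo \<open>P\<close>. Elimination would then carry an element of
  \<open>Q\<close> outside \<open>P\<close> to a nonzero element of \<open>Q\<close> in the
  variables \<open>B\<close>, against independence modulo \<open>Q\<close>.\<close>

lemma indep_mod_extend:
  fixes P Q :: "('n::finite, 'a::comm_ring_1) mpoly set"
  assumes P: "prime_subset P" and Q: "prime_subset Q" and PQ: "P \<subset> Q" and B: "indep_mod B Q"
  shows "\<exists>j. j \<notin> B \<and> indep_mod (insert j B) P"
proof (rule ccontr)
  assume no: "\<not> ?thesis"
  interpret P: prime_subset P by (rule P)
  interpret Q: prime_subset Q by (rule Q)
  \<comment> \<open>Elimination removes the variables of \<open>A\<close> one at a time; the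
    polynomial stays in \<open>Q\<close> because it changes only by a factor and an element of
    \<open>P\<close>.\<close>
  have "False" if "finite A" "f \<in> polys_in (B \<union> A)" "f \<in> Q" "f \<notin> P" for A f
    using that
  proof (induction A arbitrary: f rule: finite_induct)
    case empty
    then show ?case using B P.ideal_zero by (auto simp: indep_mod_def)
  next
    case (insert i A)
    show ?case
    proof (cases "i \<in> B")
      case True
      then show ?thesis using insert by (auto simp: insert_absorb)
    next
      case False
      interpret E: prime_extension "polys_in (B \<union> A)" P "pvar i" ..
      from no False obtain f0 where f0: "f0 \<in> polys_in (insert i B)" "f0 \<in> P" "f0 \<noteq> 0"
        by (auto simp: indep_mod_def)
      obtain p where p: "polys_in.poly_over B p" "f0 = poly p (pvar i)"
        using f0(1) unfolding polys_in_insert polys_in.adjoin_def by blast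
      have "lead_coeff p \<noteq> 0" using f0(3) p by auto
      moreover have "lead_coeff p \<in> polys_in B" using p by (intro polys_in.poly_over_coeff)
      \<comment> \<open>A nonzero polynomial in the variables \<open>B\<close> is outside
        \<open>Q\<close>, hence outside the smaller \<open>P\<close>. So the dependence is a genuine
        relation for \<open>pvar i\<close>.\<close>
      ultimately have "lead_coeff p \<notin> P" using B PQ by (auto simp: indep_mod_def)
      moreover have "polys_in.poly_over (B \<union> A) p"
        using p polys_in_mono[of B "B \<union> A"] by (auto simp: polys_in.poly_over_def)
      ultimately have "E.relation p" using f0 p by (simp add: E.relation_def)
      then obtain g where g: "E.min_relation g" using E.min_relation_exists by blast
      obtain q where q: "polys_in.poly_over (B \<union> A) q" "f = poly q (pvar i)"
        using insert.prems(1) unfolding Un_insert_right polys_in_insert polys_in.adjoin_def by blast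
      obtain v h where v: "h \<in> polys_in (B \<union> A)" "h \<notin> P" "poly v (pvar i) * f - h \<in> P"
        using E.elimination[OF g q(1)] insert.prems(3) q(2) by blast
      have "poly v (pvar i) * f - h \<in> Q" using v(3) PQ by blast
      then have "h \<in> Q"
        using Q.ideal_diff[OF Q.ideal_mult[OF insert.prems(2), of "poly v (pvar i)"]] by fastforce
      then show False using insert.IH v by blast
    qed
  qed
  moreover obtain f where "f \<in> Q" "f \<notin> P" using PQ by blast
  ultimately show False by (metis Un_UNIV_right UNIV_I finite polys_in_UNIV)
qed

text \<open>The generators \<open>G\<close> form a triangular system: each variable outside \<open>B\<close> contributes at most
  one relation, a relation of minimal degree over the preceding variables.\<close>

lemma triangular_system:
  fixes P :: "('n::finite, 'a::comm_ring_1) mpoly set"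
  assumes P: "prime_subset P" and B: "indep_mod B P" and A: "finite A"
  shows "\<exists>G. finite G \<and> card G \<le> card A \<and> G \<subseteq> P \<and>
    (\<forall>f\<in>polys_in (B \<union> A) \<inter> P. \<exists>h. h \<notin> P \<and> h * f \<in> ideal_gen G)"
  using A
proof (induction A rule: finite_induct)
  interpret prime_subset P by (rule P)
  case empty
  have "h * f \<in> ideal_gen {}" if "f \<in> polys_in B \<inter> P" for f h
    using that B by (auto simp: indep_mod_def ideal_gen_def idl.span_zero)
  then show ?case using one_notin by (intro exI[of _ "{}"]) auto
next
  interpret prime_subset P by (rule P)
  case (insert i A)
  interpret E: prime_extension "polys_in (B \<union> A)" P "pvar i" ..
  from insert.IH obtain G where G: "finite G" "card G \<le> card A" "G \<subseteq> P"
    and IH: "\<And>f. f \<in> polys_in (B \<union> A) \<inter> P \<Longrightarrow> \<exists>h. h \<notin> P \<and> h * f \<in> ideal_gen G" by blast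
  have coeffs: "\<exists>h. h \<notin> P \<and> h * poly r (pvar i) \<in> ideal_gen G"
    if r: "\<And>k. coeff r k \<in> polys_in (B \<union> A) \<inter> P" for r
  proof -
    obtain h where h: "\<And>k. h k \<notin> P" "\<And>k. h k * coeff r k \<in> ideal_gen G"
      using IH[OF r] by metis
    \<comment> \<open>A common denominator for all coefficients; it stays outside \<open>P\<close>
      because \<open>P\<close> is prime.\<close>
    let ?h = "\<Prod>k\<le>degree r. h k"
    have "?h * coeff r k \<in> ideal_gen G" if "k \<le> degree r" for k
    proof -
      have "?h * coeff r k = (\<Prod>k\<in>{..degree r} - {k}. h k) * (h k * coeff r k)"
        using that by (subst prod.remove[of _ k]) (auto simp: ac_simps)
      then show ?thesis
        using h(2) idl.subspace_scale[OF subspace_ideal_gen] by metis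
    qed
    then have "pvar i ^ k * (?h * coeff r k) \<in> ideal_gen G" if "k \<le> degree r" for k
      using that idl.subspace_scale[OF subspace_ideal_gen] by blast
    then have "?h * (coeff r k * pvar i ^ k) \<in> ideal_gen G" if "k \<le> degree r" for k
      using that by (simp only: ac_simps)
    then have "?h * poly r (pvar i) \<in> ideal_gen G"
      unfolding poly_altdef sum_distrib_left
      by (intro idl.subspace_sum[OF subspace_ideal_gen]) auto
    moreover have "?h \<notin> P" using h(1) by (rule prod_notin)
    ultimately show ?thesis by blast
  qed
  have rep: "\<exists>q. polys_in.poly_over (B \<union> A) q \<and> f = poly q (pvar i)" if "f \<in> polys_in (B \<union> insert i A)"
    for f :: "('n, 'a) mpoly"
    using that unfolding Un_insert_right polys_in_insert polys_in.adjoin_def by blast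
  show ?case
  proof (cases "\<exists>q. E.relation q")
    case False
    have "\<exists>h. h \<notin> P \<and> h * f \<in> ideal_gen G" if f: "f \<in> polys_in (B \<union> insert i A) \<inter> P" for f
    proof -
      obtain q where q: "polys_in.poly_over (B \<union> A) q" "f = poly q (pvar i)" using rep f by blast
      then have "coeff q k \<in> polys_in (B \<union> A) \<inter> P" for k
        using E.coeffs_in_ideal_transcendental[of q k] False f polys_in.poly_over_coeff by blast
      then show ?thesis using coeffs q(2) by blast
    qed
    then show ?thesis using G insert(1,2) by (intro exI[of _ G]) auto
  next
    case True
    then obtain g where g: "E.min_relation g" using E.min_relation_exists by blast
    then have g': "poly g (pvar i) \<in> P" "lead_coeff g \<notin> P"
      by (auto simp: E.min_relation_def E.relation_def)
    let ?G = "insert (poly g (pvar i)) G"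
    have sub: "ideal_gen G \<subseteq> ideal_gen ?G"
      by (intro ideal_gen_subset subspace_ideal_gen) (auto intro: ideal_gen_base)
    have "\<exists>h. h \<notin> P \<and> h * f \<in> ideal_gen ?G" if f: "f \<in> polys_in (B \<union> insert i A) \<inter> P" for f
    proof -
      obtain q where q: "polys_in.poly_over (B \<union> A) q" "f = poly q (pvar i)" using rep f by blast
      then obtain e s r where *: "\<And>k. coeff r k \<in> polys_in (B \<union> A) \<inter> P"
        "smult (lead_coeff g ^ e) q = s * g + r"
        using E.min_relation_reduce[OF g, of q] f by blast
      have eq: "lead_coeff g ^ e * f = poly s (pvar i) * poly g (pvar i) + poly r (pvar i)"
        using arg_cong[OF *(2), of "\<lambda>f. poly f (pvar i)"] q(2) by simp
      obtain h where h: "h \<notin> P" "h * poly r (pvar i) \<in> ideal_gen G" using coeffs[OF *(1)] by blast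
      have mult_eq: "(h * lead_coeff g ^ e) * f = (h * poly s (pvar i)) * poly g (pvar i) + h * poly r (pvar i)"
        by (simp add: mult.assoc eq distrib_left)
      have "h * poly r (pvar i) \<in> ideal_gen ?G" using h(2) sub by blast
      moreover have "(h * poly s (pvar i)) * poly g (pvar i) \<in> ideal_gen ?G"
        by (intro idl.subspace_scale[OF subspace_ideal_gen] ideal_gen_base) simp
      ultimately have "(h * lead_coeff g ^ e) * f \<in> ideal_gen ?G"
        unfolding mult_eq by (intro idl.subspace_add[OF subspace_ideal_gen])
      then show ?thesis using h(1) g'(2) power_notin prime_ideal by blast
    qed
    moreover have "card ?G \<le> card (insert i A)"
      using G insert(1,2) by (simp add: card_insert_if)
    ultimately show ?thesis using G g'(1) by (intro exI[of _ ?G]) auto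
  qed
qed

section \<open>Gradients at a common zero\<close>

definition grad_at :: "('n::finite, 'a::comm_semiring_1) mpoly \<Rightarrow> 'a ^ 'n \<Rightarrow> 'a ^ 'n" where
  "grad_at p x = (\<chi> i. eval_poly (partial i p) x)"

lemma grad_at_mult: "grad_at (p * q) x = eval_poly q x *s grad_at p x + eval_poly p x *s grad_at q x"
  by (simp add: grad_at_def Finite_Cartesian_Product.vec_eq_iff partial_mult eval_poly_add eval_poly_mult mult.commute)

lemma grad_at_add: "grad_at (p + q) x = grad_at p x + grad_at q x"
  by (simp add: grad_at_def Finite_Cartesian_Product.vec_eq_iff partial_add eval_poly_add)

text \<open>In the product rule, the derivatives of the coefficients are multiplied by values of
  generators, which vanish at \<open>x\<close>.\<close>

lemma grad_at_ideal_gen: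
  fixes x :: "'a::field ^ 'n::finite"
  assumes G: "\<And>g. g \<in> G \<Longrightarrow> eval_poly g x = 0" and u: "u \<in> ideal_gen G"
  shows "eval_poly u x = 0 \<and> grad_at u x \<in> vec.span ((\<lambda>g. grad_at g x) ` G)"
  using u
proof (induction rule: ideal_gen_induct)
  case zero
  have "grad_at 0 x = 0" by (simp add: grad_at_def Finite_Cartesian_Product.vec_eq_iff)
  then show ?case by (simp add: vec.span_zero)
next
  case (step a g y)
  then show ?case using G
    by (auto simp: grad_at_add grad_at_mult eval_poly_add eval_poly_mult
        intro!: vec.span_add vec.span_scale intro: vec.span_base)
qed

text \<open>As \<open>f\<close> vanishes at \<open>x\<close>, the gradient of \<open>h * f\<close>
  there is the value of \<open>h\<close> times the gradient of \<open>f\<close>; a nonvanishing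
  denominator is harmless.\<close>

lemma grad_at_quotient:
  fixes x :: "'a::field ^ 'n::finite"
  assumes "\<And>g. g \<in> G \<Longrightarrow> eval_poly g x = 0" "h * f \<in> ideal_gen G"
    and "eval_poly h x \<noteq> 0" "eval_poly f x = 0"
  shows "grad_at f x \<in> vec.span ((\<lambda>g. grad_at g x) ` G)"
proof -
  have "eval_poly h x *s grad_at f x \<in> vec.span ((\<lambda>g. grad_at g x) ` G)"
    using grad_at_ideal_gen[OF assms(1,2)] assms(4) by (simp add: grad_at_mult)
  then have "inverse (eval_poly h x) *s (eval_poly h x *s grad_at f x) \<in> vec.span ((\<lambda>g. grad_at g x) ` G)"
    by (rule vec.span_scale)
  then show ?thesis using assms(3) by (simp add: vector_smult_assoc)
qed

section \<open>Minors and rank\<close>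

lemma minors_hom:
  fixes R :: "('a::comm_ring_1 ^ 'n) list" and F :: "'a \<Rightarrow> 'b::comm_ring_1"
  assumes "comm_ring_hom F"
  shows "minors k (map (\<lambda>v. \<chi> i. F (v $ i)) R) = F ` minors k R"
proof -
  interpret comm_ring_hom F by (rule assms)
  let ?R = "map (\<lambda>v. \<chi> i. F (v $ i)) R"
  have eq: "Determinant.det (Matrix.mat k k (\<lambda>(a, b). (?R ! r a) $ s b)) =
    F (Determinant.det (Matrix.mat k k (\<lambda>(a, b). (R ! r a) $ s b)))"
    if "r ` {..<k} \<subseteq> {..<length R}" for r s
  proof -
    have "Matrix.mat k k (\<lambda>(a, b). (?R ! r a) $ s b) =
      map_mat F (Matrix.mat k k (\<lambda>(a, b). (R ! r a) $ s b))"
      using that by (intro eq_matI) (auto simp: image_subset_iff)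
    then show ?thesis by simp
  qed
  show ?thesis
    unfolding minors_def by (auto simp: eq image_iff) (metis eq)+
qed

lemma det_nonzero_independent:
  fixes v :: "nat \<Rightarrow> 'a::field ^ 'n"
  assumes "Determinant.det (Matrix.mat k k (\<lambda>(a, b). v a $ s b)) \<noteq> 0"
    and "(\<Sum>a<k. c a *s v a) = 0" and "a < k"
  shows "c a = 0"
proof (rule ccontr)
  assume "c a \<noteq> 0"
  let ?M = "Matrix.mat k k (\<lambda>(a, b). v a $ s b)"
  have M: "?M\<^sup>T \<in> carrier_mat k k" by simp
  have "?M\<^sup>T *\<^sub>v Matrix.vec k c = 0\<^sub>v k"
  proof (intro Matrix.eq_vecI)
    fix b assume "b < dim_vec (0\<^sub>v k :: 'a Matrix.vec)"
    then have b: "b < k" by simp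
    have "vec_index (?M\<^sup>T *\<^sub>v Matrix.vec k c) b = (\<Sum>a<k. c a * v a $ s b)"
      using b by (simp add: scalar_prod_def lessThan_atLeast0 mult.commute)
    also have "\<dots> = (\<Sum>a<k. c a *s v a) $ s b" by simp
    finally show "vec_index (?M\<^sup>T *\<^sub>v Matrix.vec k c) b = vec_index (0\<^sub>v k) b" using assms(2) b by simp
  qed simp
  moreover have "Matrix.vec k c \<noteq> 0\<^sub>v k"
    using \<open>c a \<noteq> 0\<close> assms(3) by (metis Matrix.index_vec index_zero_vec(1))
  ultimately have "Determinant.det ?M\<^sup>T = 0"
    using det_0_iff_vec_prod_zero_field[OF M] by (metis vec_carrier)
  then show False using assms(1) det_transpose[of ?M k] by simp
qed

text \<open>Choose columns for the first \<open>k\<close> vectors and expand along one more column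
  \<open>j\<close>. Were the determinant 0 for every \<open>j\<close>, the cofactors would be the
  coefficients of a linear relation, and the last of them is the nonzero determinant for the first
  \<open>k\<close> vectors.\<close>

lemma independent_det_nonzero:
  fixes v :: "nat \<Rightarrow> 'a::field ^ 'n"
  assumes "\<And>c a. (\<Sum>a<k. c a *s v a) = 0 \<Longrightarrow> a < k \<Longrightarrow> c a = 0"
  shows "\<exists>s. Determinant.det (Matrix.mat k k (\<lambda>(a, b). v a $ s b)) \<noteq> 0"
  using assms
proof (induction k)
  case 0
  show ?case by (simp add: det_dim_zero)
next
  case (Suc k)
  have "c a = 0" if "(\<Sum>a<k. c a *s v a) = 0" "a < k" for c a
    using Suc.prems[of "\<lambda>a. if a < k then c a else 0" a] that by simp
  then obtain s where s: "Determinant.det (Matrix.mat k k (\<lambda>(a, b). v a $ s b)) \<noteq> 0"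
    using Suc.IH by blast
  define A where "A j = Matrix.mat (Suc k) (Suc k) (\<lambda>(a, b). v a $ (s(k := j)) b)" for j
  have A: "A j \<in> carrier_mat (Suc k) (Suc k)" for j by (simp add: A_def)
  \<comment> \<open>Cofactors along the last column do not depend on its entries, so any column,
    here \<open>undefined\<close>, represents them all.\<close>
  define C where "C a = cofactor (A undefined) a k" for a
  have del: "mat_delete (A j) a k = Matrix.mat k k (\<lambda>(i, b). v (if i < a then i else Suc i) $ s b)"
    if "a \<le> k" for a j
    using that by (intro eq_matI) (auto simp: mat_delete_def A_def)
  have C: "cofactor (A j) a k = C a" if "a < Suc k" for a j
    using that by (simp add: C_def cofactor_def del)
  have "Matrix.mat k k (\<lambda>(i, b). v (if i < k then i else Suc i) $ s b) = Matrix.mat k k (\<lambda>(a, b). v a $ s b)"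
    by (intro eq_matI) auto
  then have "C k \<noteq> 0" using s by (simp add: C_def cofactor_def del)
  have "\<exists>j. Determinant.det (A j) \<noteq> 0"
  proof (rule ccontr)
    assume "\<not> ?thesis"
    then have "(\<Sum>a<Suc k. A j $$ (a, k) * cofactor (A j) a k) = 0" for j
      using laplace_expansion_column[OF A, of k j] by simp
    moreover have "(\<Sum>a<Suc k. A j $$ (a, k) * cofactor (A j) a k) = (\<Sum>a<Suc k. v a $ j * C a)" for j
    proof (rule sum.cong)
      fix a assume "a \<in> {..<Suc k}"
      then have "a < Suc k" by simp
      then show "A j $$ (a, k) * cofactor (A j) a k = v a $ j * C a"
        using C[of a j] by (simp add: A_def)
    qed simp
    ultimately have "(\<Sum>a<Suc k. v a $ j * C a) = 0" for j by metis
    then have "(\<Sum>a<Suc k. C a *s v a) = 0"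
      by (simp add: Finite_Cartesian_Product.vec_eq_iff mult.commute del: sum.lessThan_Suc)
    then show False using Suc.prems[of C k] \<open>C k \<noteq> 0\<close> by blast
  qed
  then obtain j where "Determinant.det (A j) \<noteq> 0" ..
  then show ?case unfolding A_def by blast
qed

text \<open>Columns found by \<open>independent_det_nonzero\<close> thus form an injective
  selection, as \<open>minors\<close> demands.\<close>

lemma det_nonzero_inj_on:
  assumes "Determinant.det (Matrix.mat k k (\<lambda>(a, b). (v a $ s b :: 'a::comm_ring_1))) \<noteq> 0"
  shows "inj_on s {..<k}"
proof (rule inj_onI, rule ccontr)
  let ?M = "Matrix.mat k k (\<lambda>(a, b). v a $ s b)"
  fix a b assume *: "a \<in> {..<k}" "b \<in> {..<k}" "s a = s b" "a \<noteq> b"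
  have "col ?M a = col ?M b" using * by (intro Matrix.eq_vecI) auto
  then have "Determinant.det ?M = 0"
    using det_identical_columns[of ?M k a b] * by simp
  then show False using assms by simp
qed

lemma minors_vanish_iff:
  fixes R :: "('a::field ^ 'n) list"
  shows "(\<forall>m\<in>minors k R. m = 0) \<longleftrightarrow> vec.dim (set R) < k"
proof
  assume lt: "vec.dim (set R) < k"
  show "\<forall>m\<in>minors k R. m = 0"
  proof (rule ccontr)
    assume "\<not> ?thesis"
    then obtain r s where rs: "Determinant.det (Matrix.mat k k (\<lambda>(a, b). R ! r a $ s b)) \<noteq> 0"
      "inj_on r {..<k}" "r ` {..<k} \<subseteq> {..<length R}" unfolding minors_def by blast
    define v where "v a = R ! r a" for a
    have indep: "c a = 0" if "(\<Sum>a<k. c a *s v a) = 0" "a < k" for c a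
      using det_nonzero_independent[of k v s c a] rs(1) that by (simp add: v_def)
    have inj: "inj_on v {..<k}"
    proof (rule inj_onI, rule ccontr)
      fix a b assume *: "a \<in> {..<k}" "b \<in> {..<k}" "v a = v b" "a \<noteq> b"
      let ?c = "\<lambda>i. if i = a then 1 else if i = b then - 1 else 0 :: 'a"
      have "(\<Sum>i<k. ?c i *s v i) = (\<Sum>i\<in>{a, b}. ?c i *s v i)"
        by (rule sum.mono_neutral_right) (use * in auto)
      also have "\<dots> = 0" using * by simp
      finally show False using indep[of ?c a] * by simp
    qed
    have "vec.independent (v ` {..<k})"
      unfolding vec.dependent_finite[OF finite_imageI[OF finite_lessThan]]
    proof
      assume "\<exists>u. (\<exists>w\<in>v ` {..<k}. u w \<noteq> 0) \<and> (\<Sum>w\<in>v ` {..<k}. u w *s w) = 0"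
      then obtain u a where u: "a < k" "u (v a) \<noteq> 0" "(\<Sum>w\<in>v ` {..<k}. u w *s w) = 0" by blast
      then have "(\<Sum>a<k. u (v a) *s v a) = 0" by (simp add: sum.reindex[OF inj])
      then show False using indep[of "\<lambda>a. u (v a)"] u by blast
    qed
    moreover have "v ` {..<k} \<subseteq> set R" using rs(3) by (auto simp: v_def)
    ultimately have "card (v ` {..<k}) \<le> vec.dim (set R)" by (intro vec.independent_card_le_dim)
    then show False using lt card_image[OF inj] by simp
  qed
next
  assume vanish: "\<forall>m\<in>minors k R. m = 0"
  show "vec.dim (set R) < k"
  proof (rule ccontr)
    assume not: "\<not> ?thesis"
    obtain B where B: "B \<subseteq> set R" "vec.independent B" "set R \<subseteq> vec.span B"
      "card B = vec.dim (set R)"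
      by (rule vec.basis_exists)
    then have "k \<le> card B" using not by linarith
    then obtain B' where B': "B' \<subseteq> B" "card B' = k" "finite B'"
      by (rule obtain_subset_with_card_n)
    then obtain v where v: "bij_betw v {..<k} B'"
      using ex_bij_betw_nat_finite[of B'] by (auto simp: lessThan_atLeast0)
    have indB': "vec.independent B'" using B(2) B'(1) vec.independent_mono by blast
    have "c a = 0" if c: "(\<Sum>a<k. c a *s v a) = 0" and a: "a < k" for c a
    proof -
      define u where "u w = c (the_inv_into {..<k} v w)" for w
      have u: "u (v a) = c a" if "a < k" for a
        using v that by (simp add: u_def bij_betw_def the_inv_into_f_f)
      have "(\<Sum>w\<in>B'. u w *s w) = (\<Sum>a<k. u (v a) *s v a)"
        by (rule sum.reindex_bij_betw[OF v, symmetric])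
      then have "(\<Sum>w\<in>B'. u w *s w) = 0" using c by (simp add: u)
      then have "u (v a) = 0"
        using indB' v a unfolding vec.dependent_finite[OF B'(3)] by (auto simp: bij_betw_def)
      then show ?thesis using u a by simp
    qed
    then obtain s where s: "Determinant.det (Matrix.mat k k (\<lambda>(a, b). v a $ s b)) \<noteq> 0"
      using independent_det_nonzero[where k = k and v = v] by blast
    have "v a \<in> set R" if "a < k" for a
      using bij_betwE[OF v] B'(1) B(1) that by auto
    then have "\<exists>j<length R. R ! j = v a" if "a < k" for a
      using that by (simp add: in_set_conv_nth)
    then have "\<forall>a. \<exists>j. a < k \<longrightarrow> j < length R \<and> R ! j = v a" by blast
    from choice[OF this] obtain r where r: "\<And>a. a < k \<Longrightarrow> r a < length R \<and> R ! r a = v a" by blast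
    \<comment> \<open>The list may repeat rows, but \<open>r\<close> picks positions of the distinct
      vectors \<open>v a\<close>.\<close>
    have "inj_on r {..<k}"
      using v r unfolding bij_betw_def inj_on_def by (metis lessThan_iff)
    moreover have "Matrix.mat k k (\<lambda>(a, b). R ! r a $ s b) = Matrix.mat k k (\<lambda>(a, b). v a $ s b)"
      using r by (intro eq_matI) auto
    ultimately have "Determinant.det (Matrix.mat k k (\<lambda>(a, b). v a $ s b)) \<in> minors k R"
      unfolding minors_def using r det_nonzero_inj_on[OF s]
      by (intro CollectI exI[of _ r] exI[of _ s]) auto
    then show False using vanish s by blast
  qed
qed

section \<open>Projective varieties\<close>

lemma span_line: "vec.span {x :: complex ^ 'n} - {0} = {t *s x | t. t \<noteq> 0 \<and> x \<noteq> 0}"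
  by (auto simp: vec.span_singleton)

lemma span_scale: "t \<noteq> 0 \<Longrightarrow> vec.span {t *s x} = vec.span {x :: complex ^ 'n}"
proof -
  assume t: "t \<noteq> 0"
  have "x = inverse t *s (t *s x)" using t by (simp add: vector_smult_assoc)
  then have "x \<in> vec.span {t *s x}" by (metis vec.span_base vec.span_scale singletonI)
  moreover have "t *s x \<in> vec.span {x}" by (simp add: vec.span_base vec.span_scale)
  ultimately show ?thesis by (intro equalityI vec.span_minimal vec.subspace_span) auto
qed

lemma span_in_proj_space: "x \<noteq> 0 \<Longrightarrow> vec.span {x} \<in> proj_space"
  by (auto simp: proj_space_def)

lemma proj_spaceE:
  assumes "L \<in> proj_space" obtains x where "x \<noteq> 0" "L = vec.span {x}"
  using assms by (auto simp: proj_space_def)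

lemma proj_zeros_subset: "proj_zeros S \<subseteq> proj_space"
  by (auto simp: proj_zeros_def)

text \<open>\<open>S\<close> need not consist of homogeneous polynomials, so all nonzero multiples
  of \<open>x\<close> have to be tested.\<close>

lemma span_in_proj_zeros:
  "x \<noteq> 0 \<Longrightarrow> vec.span {x} \<in> proj_zeros S \<longleftrightarrow> (\<forall>f\<in>S. \<forall>t. t \<noteq> 0 \<longrightarrow> eval_poly f (t *s x) = 0)"
  unfolding proj_zeros_def by (auto simp: span_line span_in_proj_space)

lemma span_in_real_zeros:
  "x \<noteq> 0 \<Longrightarrow> vec.span {x} \<in> real_zeros S \<longleftrightarrow> (\<forall>f\<in>S. \<forall>t. t \<noteq> 0 \<longrightarrow> reval f (t *s x) = 0)"
  by (simp add: real_zeros_def span_in_proj_zeros reval_def)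

lemma zariski_closed_subset: "zariski_closed Z \<Longrightarrow> Z \<subseteq> proj_space"
  using proj_zeros_subset by (auto simp: zariski_closed_def)

text \<open>By \<open>hcomp_vanishes\<close>, a polynomial can be replaced by its homogeneous
  components. Closed sets may from here on be given by arbitrary polynomials.\<close>

lemma zariski_closed_proj_zeros: "zariski_closed (proj_zeros S)"
proof -
  let ?T = "{hcomp d f | d f. f \<in> S}"
  have "proj_zeros S = proj_zeros ?T"
  proof (rule subset_antisym; rule subsetI)
    fix L assume L: "L \<in> proj_zeros S"
    then obtain x where x: "x \<noteq> 0" "L = vec.span {x}" using proj_zeros_subset proj_spaceE by blast
    have "eval_poly (hcomp d f) (t *s x) = 0" if "f \<in> S" for d f t
      using L x that hcomp_vanishes[of f x d] by (simp add: span_in_proj_zeros eval_homog[OF homog_hcomp])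
    then show "L \<in> proj_zeros ?T" using x by (auto simp: span_in_proj_zeros)
  next
    fix L assume L: "L \<in> proj_zeros ?T"
    then obtain x where x: "x \<noteq> 0" "L = vec.span {x}" using proj_zeros_subset proj_spaceE by blast
    have "eval_poly f (t *s x) = 0" if "f \<in> S" "t \<noteq> 0" for f t
    proof -
      obtain D where D: "(\<Sum>d\<le>D. hcomp d f) = f" using sum_hcomp by blast
      have "eval_poly (hcomp d f) (t *s x) = 0" for d
        using L x that by (auto simp: span_in_proj_zeros)
      then show ?thesis by (subst D[symmetric]) (simp add: eval_hom.hom_sum)
    qed
    then show "L \<in> proj_zeros S" using x by (simp add: span_in_proj_zeros)
  qed
  moreover have "\<forall>f\<in>?T. homogeneous f" using homog_hcomp by (auto simp: homogeneous_iff)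
  ultimately show ?thesis unfolding zariski_closed_def by blast
qed

lemma zariski_closed_Int: "zariski_closed A \<Longrightarrow> zariski_closed B \<Longrightarrow> zariski_closed (A \<inter> B)"
proof -
  assume "zariski_closed A" "zariski_closed B"
  then obtain S T where "A = proj_zeros S" "B = proj_zeros T" by (auto simp: zariski_closed_def)
  then have "A \<inter> B = proj_zeros (S \<union> T)" by (auto simp: proj_zeros_def)
  then show ?thesis by (simp add: zariski_closed_proj_zeros)
qed

lemma zariski_closed_Un:
  assumes "zariski_closed A" "zariski_closed B" shows "zariski_closed (A \<union> B)"
proof -
  obtain S T where S: "\<forall>f\<in>S. homogeneous f" "A = proj_zeros S" and T: "B = proj_zeros T"
    using assms by (auto simp: zariski_closed_def)
  have "A \<union> B = proj_zeros {f * g | f g. f \<in> S \<and> g \<in> T}"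
  proof (rule subset_antisym; rule subsetI)
    fix L assume "L \<in> A \<union> B"
    then show "L \<in> proj_zeros {f * g | f g. f \<in> S \<and> g \<in> T}"
      using S T by (auto simp: proj_zeros_def eval_poly_mult) blast+
  next
    fix L assume L: "L \<in> proj_zeros {f * g | f g. f \<in> S \<and> g \<in> T}"
    then obtain x where x: "x \<noteq> 0" "L = vec.span {x}" using proj_zeros_subset proj_spaceE by blast
    have "L \<in> B" if "L \<notin> A"
    proof -
      from that obtain f t where f: "f \<in> S" "t \<noteq> 0" "eval_poly f (t *s x) \<noteq> 0"
        using x S by (auto simp: span_in_proj_zeros)
      obtain d where d: "homog d f" using S f by (auto simp: homogeneous_iff)
      \<comment> \<open>Homogeneity carries nonvanishing from one multiple of \<open>x\<close> to
        all, so that every \<open>g\<close> in \<open>T\<close> has to vanish along the whole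
        line.\<close>
      have "eval_poly f (u *s x) \<noteq> 0" if "u \<noteq> 0" for u
        using f that by (simp add: eval_homog[OF d])
      moreover have "eval_poly f (u *s x) * eval_poly g (u *s x) = 0" if "g \<in> T" "u \<noteq> 0" for g u
        using L x that f(1) by (fastforce simp: span_in_proj_zeros eval_poly_mult)
      ultimately show ?thesis using x by (auto simp: T span_in_proj_zeros)
    qed
    then show "L \<in> A \<union> B" by blast
  qed
  then show ?thesis by (simp add: zariski_closed_proj_zeros)
qed

text \<open>The equations are the 2 by 2 minors of the matrix with rows \<open>x\<close> and
  \<open>y\<close>, which express that the two are proportional.\<close>

lemma zariski_closed_point:
  assumes "x \<noteq> 0" shows "zariski_closed {vec.span {x :: complex ^ 'n::finite}}"
proof -
  let ?f = "\<lambda>i j. Poly_Mapping.single 0 (x $ i) * pvar j - Poly_Mapping.single 0 (x $ j) * pvar i"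
  have "{vec.span {x}} = proj_zeros {?f i j | i j. True}"
  proof (rule subset_antisym; rule subsetI)
    fix L assume "L \<in> {vec.span {x}}"
    then show "L \<in> proj_zeros {?f i j | i j. True}"
      using assms by (auto simp: span_in_proj_zeros eval_hom.hom_minus eval_poly_mult eval_poly_single)
  next
    fix L assume L: "L \<in> proj_zeros {?f i j | i j. True}"
    then obtain y where y: "y \<noteq> 0" "L = vec.span {y}" using proj_zeros_subset proj_spaceE by blast
    have all: "\<forall>f\<in>{?f i j | i j. True}. \<forall>t. t \<noteq> 0 \<longrightarrow> eval_poly f (t *s y) = 0"
      using L unfolding y(2) span_in_proj_zeros[OF y(1)] .
    have "eval_poly (?f i j) (1 *s y) = 0" for i j
      by (rule all[rule_format]) auto
    then have eq: "x $ i * y $ j = x $ j * y $ i" for i j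
      by (simp add: eval_hom.hom_minus eval_poly_mult eval_poly_single)
    obtain i where i: "x $ i \<noteq> 0" using assms by (auto simp: Finite_Cartesian_Product.vec_eq_iff)
    have "y = (y $ i / x $ i) *s x"
      using eq[of i] i by (simp add: Finite_Cartesian_Product.vec_eq_iff field_simps)
    moreover from this have "y $ i / x $ i \<noteq> 0" using y(1) by auto
    ultimately have "vec.span {y} = vec.span {x}" using span_scale[of "y $ i / x $ i" x] by simp
    then show "L \<in> {vec.span {x}}" using y(2) by simp
  qed
  then show ?thesis by (simp add: zariski_closed_proj_zeros)
qed

lemma zariski_closed_finite:
  fixes A :: "(complex ^ 'n::finite) set set"
  assumes "finite A" "A \<subseteq> proj_space" shows "zariski_closed A"
  using assms
proof (induction A rule: finite_induct)
  case empty
  have "L \<notin> proj_zeros {1 :: ('n, complex) mpoly}" for L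
  proof
    assume L: "L \<in> proj_zeros {1 :: ('n, complex) mpoly}"
    then obtain x where "x \<noteq> 0" "L = vec.span {x}" using proj_zeros_subset proj_spaceE by blast
    then have "\<forall>t::complex. t \<noteq> 0 \<longrightarrow> (1::complex) = 0" using L by (simp add: span_in_proj_zeros)
    then show False using one_neq_zero by blast
  qed
  then have "proj_zeros {1 :: ('n, complex) mpoly} = {}" by blast
  then show ?case using zariski_closed_proj_zeros by metis
next
  case (insert L A)
  then obtain x where "x \<noteq> 0" "L = vec.span {x}" by (auto elim: proj_spaceE)
  then have "zariski_closed {L}" using zariski_closed_point by blast
  moreover have "zariski_closed A" using insert by simp
  ultimately have "zariski_closed ({L} \<union> A)" by (rule zariski_closed_Un)
  then show ?case by simp
qed

text \<open>The complex counterpart of \<open>vanishing_ideal\<close>. The varieties in a chain that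
  measures dimension need not be defined over the reals, so their real ideals would not determine
  them.\<close>

definition cvanish :: "(complex ^ 'n::finite) set set \<Rightarrow> ('n, complex) mpoly set" where
  "cvanish Z = {f. \<forall>L\<in>Z. \<forall>x\<in>L - {0}. eval_poly f x = 0}"

lemma proj_zeros_cvanish: "zariski_closed Z \<Longrightarrow> proj_zeros (cvanish Z) = Z"
proof
  assume Z: "zariski_closed Z"
  then obtain S where S: "Z = proj_zeros S" by (auto simp: zariski_closed_def)
  then have "S \<subseteq> cvanish Z" by (auto simp: cvanish_def proj_zeros_def)
  then show "proj_zeros (cvanish Z) \<subseteq> Z" using S by (auto simp: proj_zeros_def)
  show "Z \<subseteq> proj_zeros (cvanish Z)"
    using zariski_closed_subset[OF Z] by (auto simp: proj_zeros_def cvanish_def)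
qed

lemma eval_on_line: "\<exists>p. \<forall>t. eval_poly f (t *s x) = poly p (t :: complex)"
proof (induction f rule: mpoly_induct)
  case (single m a)
  show ?case
    by (intro exI[of _ "monom (a * monom_val m x) (mdeg m)"])
      (simp add: eval_poly_single monom_val_scale poly_monom)
next
  case (add f g)
  then obtain p q where "\<forall>t. eval_poly f (t *s x) = poly p t" "\<forall>t. eval_poly g (t *s x) = poly q t"
    by blast
  then show ?case by (intro exI[of _ "p + q"]) (simp add: eval_poly_add)
qed

text \<open>For inhomogeneous factors it is not enough that at each multiple of \<open>x\<close> one
  of them vanishes. Both restrict to polynomials in \<open>t\<close>, and if the product of these is
  0, one of them is 0.\<close>

lemma line_irreducible:
  assumes "x \<noteq> 0" "vec.span {x} \<in> proj_zeros {f * g}"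
  shows "vec.span {x} \<in> proj_zeros {f} \<or> vec.span {x} \<in> proj_zeros {g}"
proof -
  obtain p q where p: "\<And>t. eval_poly f (t *s x) = poly p t" and q: "\<And>t. eval_poly g (t *s x) = poly q t"
    using eval_on_line by metis
  have "poly (p * q) t = 0" if "t \<noteq> 0" for t
    using assms that p q by (simp add: span_in_proj_zeros eval_poly_mult)
  then have "- {0} \<subseteq> {t. poly (p * q) t = 0}" by blast
  moreover have "infinite (- {0 :: complex})" by (simp add: infinite_UNIV_char_0 finite_compl)
  ultimately have "p * q = 0" using poly_roots_finite finite_subset by blast
  then show ?thesis using assms(1) p q by (auto simp: span_in_proj_zeros)
qed

lemma prime_subset_cvanish:
  assumes Z: "irreducible_variety Z" shows "prime_subset (cvanish Z)"
proof
  have closed: "zariski_closed Z" and ne: "Z \<noteq> {}" using Z by (auto simp: irreducible_variety_def)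
  show "0 \<in> cvanish Z" by (simp add: cvanish_def)
  show "a + b \<in> cvanish Z" if "a \<in> cvanish Z" "b \<in> cvanish Z" for a b
    using that by (simp add: cvanish_def eval_poly_add)
  show "a * b \<in> cvanish Z" if "b \<in> cvanish Z" for a b
    using that by (simp add: cvanish_def eval_poly_mult)
  obtain L where "L \<in> Z" using ne by blast
  moreover from this obtain x where "x \<noteq> 0" "L = vec.span {x}"
    using zariski_closed_subset[OF closed] proj_spaceE by blast
  moreover from this have "x \<in> L - {0}" by (simp add: vec.span_base)
  ultimately show "1 \<notin> cvanish Z" by (auto simp: cvanish_def)
  show "a \<in> cvanish Z \<or> b \<in> cvanish Z" if ab: "a * b \<in> cvanish Z" for a b
  proof -
    have "Z = (Z \<inter> proj_zeros {a}) \<union> (Z \<inter> proj_zeros {b})"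
    proof (intro equalityI subsetI)
      fix L assume L: "L \<in> Z"
      then obtain x where x: "x \<noteq> 0" "L = vec.span {x}"
        using zariski_closed_subset[OF closed] proj_spaceE by blast
      have "L \<in> proj_zeros {a * b}"
        using L ab zariski_closed_subset[OF closed] by (auto simp: proj_zeros_def cvanish_def)
      then show "L \<in> (Z \<inter> proj_zeros {a}) \<union> (Z \<inter> proj_zeros {b})"
        using L x line_irreducible by blast
    qed blast
    moreover have "zariski_closed (Z \<inter> proj_zeros {a})" "zariski_closed (Z \<inter> proj_zeros {b})"
      using closed by (auto intro: zariski_closed_Int zariski_closed_proj_zeros)
    ultimately have "Z = Z \<inter> proj_zeros {a} \<or> Z = Z \<inter> proj_zeros {b}"
      using Z unfolding irreducible_variety_def by blast
    then show ?thesis by (auto simp: cvanish_def proj_zeros_def)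
  qed
qed

text \<open>The homogeneous components of a polynomial in one variable are single terms, and none of
  positive or zero degree vanishes where that variable is nonzero unless its coefficient is 0. This
  gives the first of the \<open>d + 1\<close> independent variables.\<close>

lemma indep_mod_point:
  fixes x :: "complex ^ 'n::finite"
  assumes L: "vec.span {x} \<in> Z" and i: "x $ i \<noteq> 0"
  shows "indep_mod {i} (cvanish Z)"
  unfolding indep_mod_def
proof (intro subsetI, rule ccontr)
  fix f assume f: "f \<in> polys_in {i} \<inter> cvanish Z" "f \<notin> {0}"
  have x: "x \<noteq> 0" using i by auto
  have "eval_poly f (t *s x) = 0" if "t \<noteq> 0" for t
  proof -
    have "t *s x \<in> vec.span {x} - {0}" using x that by (auto simp: span_line)
    then show ?thesis using f L by (auto simp: cvanish_def)
  qed
  then have van: "eval_poly (hcomp d f) x = 0" for d by (rule hcomp_vanishes)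
  obtain m where m: "m \<in> Poly_Mapping.keys f" using f by (metis ex_in_conv keys_eq_empty singletonI)
  have single: "n = Poly_Mapping.single i (mdeg n)" if "Poly_Mapping.keys n \<subseteq> {i}" for n :: "'n \<Rightarrow>\<^sub>0 nat"
  proof (rule poly_mapping_eqI)
    have 0: "Poly_Mapping.lookup n j = 0" if "j \<noteq> i" for j
      using \<open>Poly_Mapping.keys n \<subseteq> {i}\<close> that by (auto simp: in_keys_iff)
    then have "mdeg n = Poly_Mapping.lookup n i"
      unfolding mdeg_def by (subst sum.remove[of _ i]) auto
    then show "Poly_Mapping.lookup n j = Poly_Mapping.lookup (Poly_Mapping.single i (mdeg n)) j" for j
      using 0 by (simp add: lookup_single when_def)
  qed
  have uniq: "n = m" if "n \<in> Poly_Mapping.keys f" "mdeg n = mdeg m" for n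
    using single[of n] single[of m] f that m unfolding polys_in_def by auto
  have "{n \<in> Poly_Mapping.keys f. mdeg n = mdeg m} = {m}" using m uniq by blast
  then have "hcomp (mdeg m) f = Poly_Mapping.single m (Poly_Mapping.lookup f m)"
    by (simp add: hcomp_def)
  then have "eval_poly (hcomp (mdeg m) f) x = Poly_Mapping.lookup f m * monom_val m x"
    by (simp add: eval_poly_single)
  moreover have "monom_val m x = (x $ i) ^ mdeg m"
    using single[of m] f m monom_val_single[of i "mdeg m" x] by (auto simp: polys_in_def)
  ultimately show False using van i m by (auto simp: in_keys_iff)
qed

lemma irreducible_chain_indep:
  assumes "irreducible_chain V d"
  shows "\<exists>B. card B = Suc d \<and> indep_mod B (cvanish V)"
proof -
  obtain Z where Z: "\<And>i. i \<le> d \<Longrightarrow> irreducible_variety (Z i) \<and> Z i \<subseteq> V"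
    and chain: "\<And>i. i < d \<Longrightarrow> Z i \<subset> Z (Suc i)"
    using assms by (auto simp: irreducible_chain_def)
  have closed: "zariski_closed (Z i)" if "i \<le> d" for i
    using Z[OF that] by (simp add: irreducible_variety_def)
  have anti: "cvanish B \<subseteq> cvanish A" if "A \<subseteq> B" for A B using that by (auto simp: cvanish_def)
  have "i \<le> d \<Longrightarrow> \<exists>B. card B = Suc i \<and> indep_mod B (cvanish (Z i))" for i
  proof (induction i)
    case 0
    obtain L where L: "L \<in> Z 0" using Z[of 0] by (auto simp: irreducible_variety_def)
    then obtain x where x: "x \<noteq> 0" "L = vec.span {x}"
      using zariski_closed_subset[OF closed[of 0]] proj_spaceE by blast
    then obtain j where "x $ j \<noteq> 0" by (auto simp: Finite_Cartesian_Product.vec_eq_iff)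
    then have "indep_mod {j} (cvanish (Z 0))" using indep_mod_point L x by blast
    then show ?case by (intro exI[of _ "{j}"]) simp
  next
    case (Suc i)
    then obtain B where B: "card B = Suc i" "indep_mod B (cvanish (Z i))" by auto
    \<comment> \<open>Strict because a closed set is recovered from its ideal by
      \<open>proj_zeros_cvanish\<close>.\<close>
    have "cvanish (Z (Suc i)) \<subset> cvanish (Z i)"
      using chain[of i] Suc.prems anti[of "Z i" "Z (Suc i)"]
        proj_zeros_cvanish[OF closed[of i]] proj_zeros_cvanish[OF closed[of "Suc i"]] by auto
    then obtain j where "j \<notin> B" "indep_mod (insert j B) (cvanish (Z (Suc i)))"
      using indep_mod_extend[OF prime_subset_cvanish prime_subset_cvanish _ B(2), of "Z (Suc i)"]
        Z[of i] Z[of "Suc i"] Suc.prems by auto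
    moreover from this have "card (insert j B) = Suc (Suc i)"
      using B(1) by (simp add: card_insert_if)
    ultimately show ?case by blast
  qed
  from this[of d] obtain B where "card B = Suc d" "indep_mod B (cvanish (Z d))" by auto
  moreover have "cvanish V \<subseteq> cvanish (Z d)" using Z[of d] by (intro anti) auto
  ultimately show ?thesis by (auto simp: indep_mod_def)
qed

lemma jac_rank_le_codimension:
  fixes V :: "(complex ^ 'n::finite) set set"
  assumes V: "irreducible_variety V" and c: "has_codimension V c"
    and fs: "set fs \<subseteq> cvanish V" and x: "x \<noteq> 0" "vec.span {x} \<in> V"
  shows "vec.dim ((\<lambda>f. grad_at f x) ` set fs) \<le> c"
proof (rule ccontr)
  interpret prime_subset "cvanish V" by (rule prime_subset_cvanish[OF V])
  assume "\<not> ?thesis"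
  then have gt: "\<not> vec.dim (set (map (\<lambda>f. grad_at f x) fs)) < Suc c" by simp
  obtain d where d: "irreducible_chain V d" "d + c = CARD('n) - 1"
    using c by (auto simp: has_codimension_def has_dimension_def)
  obtain B where B: "card B = Suc d" "indep_mod B (cvanish V)"
    using irreducible_chain_indep[OF d(1)] by blast
  obtain G where G: "finite G" "card G \<le> card (- B)" "G \<subseteq> cvanish V"
    "\<And>f. f \<in> cvanish V \<Longrightarrow> \<exists>h. h \<notin> cvanish V \<and> h * f \<in> ideal_gen G"
    using triangular_system[OF prime_subset_cvanish[OF V] B(2), of "- B"] by auto
  \<comment> \<open>The complement of \<open>B\<close> has \<open>CARD('n) - Suc d = c\<close>
    elements.\<close>
  have cG: "card G \<le> c"
    using G(2) B(1) d(2) by (simp add: Compl_eq_Diff_UNIV card_Diff_subset)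
  define h where "h f = (SOME h. h \<notin> cvanish V \<and> h * f \<in> ideal_gen G)" for f
  have h: "h f \<notin> cvanish V" "h f * f \<in> ideal_gen G" if "f \<in> cvanish V" for f
    using someI_ex[OF G(4)[OF that]] by (auto simp: h_def)
  have grads: "map (\<lambda>f. grad_at f y) fs = map (\<lambda>v. \<chi> i. eval_poly (v $ i) y) (map poly_grad fs)" for y
    by (simp add: grad_at_def poly_grad_def)
  have "\<exists>M\<in>minors (Suc c) (map poly_grad fs). eval_poly M x \<noteq> 0"
    using gt unfolding minors_vanish_iff[symmetric] grads
      minors_hom[OF eval_hom.comm_ring_hom_axioms] by blast
  then obtain M where M: "M \<in> minors (Suc c) (map poly_grad fs)" "eval_poly M x \<noteq> 0" ..
  have "x \<in> vec.span {x} - {0}" using x by (simp add: vec.span_base)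
  then have "M \<notin> cvanish V" using M(2) x(2) by (auto simp: cvanish_def)
  moreover have "prod h (set fs) \<notin> cvanish V" using h fs by (intro prod_notin) blast
  ultimately have "M * prod h (set fs) \<notin> cvanish V" using prime_ideal by blast
  \<comment> \<open>At this general point \<open>y\<close> the minor \<open>M\<close> still shows
    rank above \<open>c\<close>, while all denominators \<open>h f\<close> are nonzero, so the
    gradients lie in the span of those of \<open>G\<close>, at most \<open>c\<close> in
    number.\<close>
  then obtain L y where y: "L \<in> V" "y \<in> L - {0}" "eval_poly (M * prod h (set fs)) y \<noteq> 0"
    by (auto simp: cvanish_def)
  have van: "eval_poly f y = 0" if "f \<in> cvanish V" for f using that y by (auto simp: cvanish_def)
  have My: "eval_poly M y \<noteq> 0" and hy: "\<And>f. f \<in> set fs \<Longrightarrow> eval_poly (h f) y \<noteq> 0"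
    using y(3) by (auto simp: eval_poly_mult eval_hom.hom_prod)
  have "grad_at f y \<in> vec.span ((\<lambda>g. grad_at g y) ` G)" if "f \<in> set fs" for f
    using that fs h(2)[of f] hy[of f] van G(3) by (intro grad_at_quotient[of G y "h f" f]) auto
  then have "vec.dim ((\<lambda>f. grad_at f y) ` set fs) \<le> card ((\<lambda>g. grad_at g y) ` G)"
    using G(1) by (intro vec.dim_le_card) auto
  also have "\<dots> \<le> c" using card_image_le[OF G(1)] cG by (rule order_trans)
  finally have "vec.dim (set (map (\<lambda>f. grad_at f y) fs)) < Suc c" by simp
  then show False
    using My M(1) unfolding minors_vanish_iff[symmetric] grads
      minors_hom[OF eval_hom.comm_ring_hom_axioms] by blast
qed

section \<open>The Rayleigh quotient\<close>

lemma reval_var_vec: "reval (var_vec $ i) x = x $ i"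
  using reval_pvar[of i x] by (simp add: var_vec_def pvar_def)

lemma reval_const_poly: "reval (const_poly a) x = of_real a"
  by (simp add: const_poly_def reval_single)

lemma reval_norm_poly: "reval norm_poly x = scalar_product x x"
  by (simp add: norm_poly_def scalar_product_def reval_hom.hom_sum reval_hom.hom_mult reval_var_vec)

lemma scalar_product_scale: "scalar_product (s *s x) (t *s y) = s * t * scalar_product x (y :: 'a::comm_ring_1 ^ 'n)"
  by (simp add: scalar_product_def sum_distrib_left ac_simps)

definition rayleigh_vec :: "real ^ 'n ^ 'n \<Rightarrow> complex ^ 'n::finite \<Rightarrow> complex ^ 'n" where
  "rayleigh_vec H x = (\<chi> i. reval (rayleigh_row H $ i) x)"

lemma symmetric_entry: "transpose H = H \<Longrightarrow> H $ j $ i = H $ i $ j"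
proof -
  assume H: "transpose H = H"
  have "H $ j $ i = transpose H $ i $ j" by (simp add: transpose_def)
  then show ?thesis by (simp only: H)
qed

lemma rayleigh_vec_eq:
  assumes "transpose H = H"
  shows "rayleigh_vec H x = scalar_product x x *s (map_matrix complex_of_real H *v x)
    - scalar_product x (map_matrix complex_of_real H *v x) *s x"
proof -
  let ?A = "map_matrix complex_of_real H"
  have row: "reval ((var_vec v* map_matrix const_poly H) $ i) x = (?A *v x) $ i" for i
  proof -
    have "reval ((var_vec v* map_matrix const_poly H) $ i) x = (\<Sum>j\<in>UNIV. x $ j * of_real (H $ j $ i))"
      by (simp add: vector_matrix_mult_def reval_hom.hom_sum reval_hom.hom_mult reval_var_vec reval_const_poly)
    also have "\<dots> = (\<Sum>j\<in>UNIV. of_real (H $ i $ j) * x $ j)"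
      using symmetric_entry[OF assms, of _ i] by (intro sum.cong) auto
    finally show ?thesis by (simp add: matrix_vector_mult_def)
  qed
  have "reval (scalar_product var_vec (map_matrix const_poly H *v var_vec)) x = scalar_product x (?A *v x)"
    by (simp add: scalar_product_def matrix_vector_mult_def reval_hom.hom_sum reval_hom.hom_mult
        reval_var_vec reval_const_poly)
  then show ?thesis
    by (simp add: Finite_Cartesian_Product.vec_eq_iff rayleigh_vec_def rayleigh_row_def Let_def
        reval_hom.hom_minus reval_hom.hom_mult reval_norm_poly reval_var_vec row)
qed

lemma rayleigh_vec_scale:
  assumes "transpose H = H"
  shows "rayleigh_vec H (t *s x) = t ^ 3 *s rayleigh_vec H x"
  unfolding rayleigh_vec_eq[OF assms] vector_scalar_commute scalar_product_scale
  by (simp add: Finite_Cartesian_Product.vec_eq_iff power3_eq_cube algebra_simps)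

text \<open>The first row of the augmented matrix is the gradient cleared of its denominator, up to
  the factor 2. The 2 arises because symmetry of \<open>H\<close> makes the two halves of the
  derivative of the quadratic form equal.\<close>

lemma holo_grad_rayleigh_quotient:
  assumes H: "transpose H = H" and x: "scalar_product x x \<noteq> 0"
  shows "holo_grad (rayleigh_quotient H) x = (2 / (scalar_product x x)\<^sup>2) *s rayleigh_vec H x"
proof -
  define A where "A = map_matrix complex_of_real H"
  have sym: "A $ j $ i = A $ i $ j" for i j
    using symmetric_entry[OF H] by (simp add: A_def)
  have "deriv (\<lambda>t. rayleigh_quotient H (x + axis i t)) 0 =
    ((2 / (scalar_product x x)\<^sup>2) *s rayleigh_vec H x) $ i" for i
  proof -
    let ?u = "\<lambda>a t. x $ a + (if a = i then t else 0)"
    let ?d = "\<lambda>a. if a = i then 1 else 0 :: complex"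
    have u: "(?u a has_field_derivative ?d a) (at 0)" for a
      by (cases "a = i") (auto intro!: derivative_eq_intros)
    have N: "((\<lambda>t. \<Sum>a\<in>UNIV. ?u a t * (\<Sum>b\<in>UNIV. A $ a $ b * ?u b t)) has_field_derivative
      (\<Sum>a\<in>UNIV. ?d a * (\<Sum>b\<in>UNIV. A $ a $ b * ?u b 0) + (\<Sum>b\<in>UNIV. A $ a $ b * ?d b) * ?u a 0)) (at 0)"
      by (intro DERIV_sum DERIV_mult DERIV_cmult u)
    have N': "(\<Sum>a\<in>UNIV. ?d a * (\<Sum>b\<in>UNIV. A $ a $ b * ?u b 0) + (\<Sum>b\<in>UNIV. A $ a $ b * ?d b) * ?u a 0)
      = 2 * (A *v x) $ i"
    proof -
      have "(\<Sum>a\<in>UNIV. ?d a * (\<Sum>b\<in>UNIV. A $ a $ b * ?u b 0)) = (A *v x) $ i"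
        by (simp add: matrix_vector_mult_def if_distrib[of "\<lambda>c. c * _"] cong: if_cong)
      moreover have "(\<Sum>a\<in>UNIV. (\<Sum>b\<in>UNIV. A $ a $ b * ?d b) * ?u a 0) = (\<Sum>a\<in>UNIV. A $ i $ a * x $ a)"
      proof (rule sum.cong)
        fix a
        show "(\<Sum>b\<in>UNIV. A $ a $ b * ?d b) * ?u a 0 = A $ i $ a * x $ a"
          using sym[of a i] by (simp add: if_distrib[of "\<lambda>c. _ * c"] cong: if_cong)
      qed simp
      ultimately show ?thesis by (simp add: sum.distrib matrix_vector_mult_def)
    qed
    have D: "((\<lambda>t. \<Sum>a\<in>UNIV. ?u a t * ?u a t) has_field_derivative
      (\<Sum>a\<in>UNIV. ?d a * ?u a 0 + ?d a * ?u a 0)) (at 0)"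
      by (intro DERIV_sum DERIV_mult u)
    have D': "(\<Sum>a\<in>UNIV. ?d a * ?u a 0 + ?d a * ?u a 0) = 2 * x $ i"
      by (simp add: if_distrib[of "\<lambda>c. _ * c"] cong: if_cong)
    have D0: "(\<Sum>a\<in>UNIV. ?u a 0 * ?u a 0) = scalar_product x x"
      by (simp add: scalar_product_def)
    have N0: "(\<Sum>a\<in>UNIV. ?u a 0 * (\<Sum>b\<in>UNIV. A $ a $ b * ?u b 0)) = scalar_product x (A *v x)"
      by (simp add: scalar_product_def matrix_vector_mult_def)
    have eq: "(\<lambda>t. rayleigh_quotient H (x + axis i t)) =
      (\<lambda>t. (\<Sum>a\<in>UNIV. ?u a t * (\<Sum>b\<in>UNIV. A $ a $ b * ?u b t)) / (\<Sum>a\<in>UNIV. ?u a t * ?u a t))"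
      by (simp add: rayleigh_quotient_def A_def[symmetric] scalar_product_def matrix_vector_mult_def axis_def)
    have "((\<lambda>t. rayleigh_quotient H (x + axis i t)) has_field_derivative
      (2 * (A *v x) $ i * scalar_product x x - scalar_product x (A *v x) * (2 * x $ i)) /
        (scalar_product x x * scalar_product x x)) (at 0)"
      unfolding eq using DERIV_divide[OF N D] x unfolding N' D' D0 N0 by simp
    then have "deriv (\<lambda>t. rayleigh_quotient H (x + axis i t)) 0 =
      (2 * (A *v x) $ i * scalar_product x x - scalar_product x (A *v x) * (2 * x $ i)) /
        (scalar_product x x * scalar_product x x)"
      by (rule DERIV_imp_deriv)
    also have "\<dots> = ((2 / (scalar_product x x)\<^sup>2) *s rayleigh_vec H x) $ i"
      unfolding rayleigh_vec_eq[OF H] A_def[symmetric]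
      by (simp add: power2_eq_square algebra_simps diff_divide_distrib)
    finally show ?thesis .
  qed
  then show ?thesis
    by (simp add: holo_grad_def Finite_Cartesian_Product.vec_eq_iff)
qed

section \<open>Critical points\<close>

lemma in_vanishing_ideal:
  assumes "Z \<subseteq> proj_space"
  shows "f \<in> vanishing_ideal Z \<longleftrightarrow> (\<forall>x. x \<noteq> 0 \<longrightarrow> vec.span {x} \<in> Z \<longrightarrow> reval f x = 0)"
proof
  assume f: "f \<in> vanishing_ideal Z"
  show "\<forall>x. x \<noteq> 0 \<longrightarrow> vec.span {x} \<in> Z \<longrightarrow> reval f x = 0"
  proof (intro allI impI)
    fix x :: "complex ^ 'a" assume x: "x \<noteq> 0" "vec.span {x} \<in> Z"
    then have "x \<in> vec.span {x} - {0}" by (simp add: vec.span_base)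
    then show "reval f x = 0" using f x by (auto simp: vanishing_ideal_def reval_def)
  qed
next
  assume *: "\<forall>x. x \<noteq> 0 \<longrightarrow> vec.span {x} \<in> Z \<longrightarrow> reval f x = 0"
  show "f \<in> vanishing_ideal Z"
    unfolding vanishing_ideal_def
  proof (intro CollectI ballI)
    fix L x assume L: "L \<in> Z" "x \<in> L - {0}"
    then obtain y where y: "L = vec.span {y}" using assms proj_spaceE by blast
    then obtain t where "x = t *s y" "t \<noteq> 0" using L by (auto simp: span_line)
    then have "vec.span {x} \<in> Z" using L y by (simp add: span_scale)
    then show "eval_poly (complexify f) x = 0" using * L by (simp add: reval_def)
  qed
qed

lemma subspace_vanishing_ideal: "idl.subspace (vanishing_ideal Z)"
  unfolding idl.subspace_def vanishing_ideal_def
  by (auto simp: reval_def[symmetric] reval_hom.hom_add reval_hom.hom_mult)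

lemma subspace_ideal_sum:
  assumes "idl.subspace I" "idl.subspace J" shows "idl.subspace (ideal_sum I J)"
  unfolding idl.subspace_def
proof (intro conjI ballI allI)
  have "0 + 0 \<in> ideal_sum I J"
    using assms unfolding ideal_sum_def by (blast intro: idl.subspace_0)
  then show "0 \<in> ideal_sum I J" by simp
next
  fix x y assume "x \<in> ideal_sum I J" "y \<in> ideal_sum I J"
  then obtain a b a' b' where "a \<in> I" "b \<in> J" "a' \<in> I" "b' \<in> J" "x = a + b" "y = a' + b'"
    by (auto simp: ideal_sum_def)
  then have "a + a' \<in> I" "b + b' \<in> J" "x + y = (a + a') + (b + b')"
    using assms by (auto intro: idl.subspace_add)
  then show "x + y \<in> ideal_sum I J" unfolding ideal_sum_def by blast
next
  fix r x assume "x \<in> ideal_sum I J"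
  then obtain a b where "a \<in> I" "b \<in> J" "x = a + b" by (auto simp: ideal_sum_def)
  then have "r * a \<in> I" "r * b \<in> J" "r * x = r * a + r * b"
    using assms by (auto intro: idl.subspace_scale simp: distrib_left)
  then show "r * x \<in> ideal_sum I J" unfolding ideal_sum_def by blast
qed

lemma reval_minors:
  "(\<forall>m\<in>minors k R. reval m x = 0) \<longleftrightarrow> vec.dim ((\<lambda>v. \<chi> i. reval (v $ i) x) ` set R) < k"
proof -
  have "(\<forall>m\<in>minors k R. reval m x = 0) \<longleftrightarrow> (\<forall>m\<in>minors k (map (\<lambda>v. \<chi> i. reval (v $ i) x) R). m = 0)"
    unfolding minors_hom[OF reval_hom.comm_ring_hom_axioms] by auto
  then show ?thesis by (simp add: minors_vanish_iff)
qed

lemma span_in_isotropic: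
  "x \<noteq> 0 \<Longrightarrow> vec.span {x} \<in> isotropic_quadric \<longleftrightarrow> scalar_product x x = 0"
  unfolding isotropic_quadric_def span_in_real_zeros
  by (auto simp: reval_norm_poly scalar_product_scale dest: spec[of _ 1])

text \<open>\<open>real_V\<close> says that \<open>V\<close> is defined by real polynomials, as its
  ideal is; irreducibility refers to closed sets given by complex ones.\<close>

locale rayleigh_problem =
  fixes V :: "(complex ^ 'n::finite) set set"
    and gs :: "('n, real) mpoly list"
    and c :: nat
    and H :: "real ^ 'n ^ 'n"
  assumes irred: "irreducible_variety V"
    and codim: "has_codimension V c"
    and real_V: "real_zeros (vanishing_ideal V) = V"
    and gens: "ideal_gen (set gs) = vanishing_ideal V"
    and sym: "transpose H = H"
begin

abbreviation "jac x \<equiv> jac_row_span gs x"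
abbreviation "sing \<equiv> singular_locus gs c V"
abbreviation "crit \<equiv> critical_points gs c V H"
abbreviation "jac_minors \<equiv> minors c (map poly_grad gs)"
abbreviation "aug_minors \<equiv> minors (c + 1) (rayleigh_row H # map poly_grad gs)"
abbreviation "crit_base \<equiv> ideal_sum (vanishing_ideal V) (ideal_gen aug_minors)"
abbreviation "bad_ideal \<equiv> ideal_prod (vanishing_ideal sing) (ideal_gen {norm_poly})"

lemma V_proj: "V \<subseteq> proj_space"
  using irred zariski_closed_subset by (auto simp: irreducible_variety_def)

lemmas in_ideal_V = in_vanishing_ideal[OF V_proj]

lemma hcomp_in_ideal_V: "f \<in> vanishing_ideal V \<Longrightarrow> hcomp d f \<in> vanishing_ideal V"
proof -
  assume f: "f \<in> vanishing_ideal V"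
  have "reval (hcomp d f) x = 0" if x: "x \<noteq> 0" "vec.span {x} \<in> V" for x
  proof -
    have "eval_poly (complexify f) (t *s x) = 0" if "t \<noteq> 0" for t
      using f x that in_ideal_V[of f] span_scale[OF that, of x] by (simp add: reval_def)
    then show ?thesis unfolding reval_def complexify_hcomp by (rule hcomp_vanishes)
  qed
  then show ?thesis by (simp add: in_ideal_V)
qed

text \<open>A single representative suffices because the homogeneous components of a member of the
  ideal are members again.\<close>

lemma span_in_V:
  assumes "x \<noteq> 0" shows "vec.span {x} \<in> V \<longleftrightarrow> (\<forall>f\<in>vanishing_ideal V. reval f x = 0)"
proof
  assume "vec.span {x} \<in> V"
  then show "\<forall>f\<in>vanishing_ideal V. reval f x = 0" using assms by (auto simp: in_ideal_V)
next
  assume *: "\<forall>f\<in>vanishing_ideal V. reval f x = 0"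
  have "reval f (t *s x) = 0" if "f \<in> vanishing_ideal V" for f t
  proof -
    obtain D where D: "(\<Sum>d\<le>D. hcomp d f) = f" using sum_hcomp by blast
    have "reval (hcomp d f) (t *s x) = 0" for d
    proof -
      have "homog d (complexify (hcomp d f))" by (simp add: homog_complexify homog_hcomp)
      then have "reval (hcomp d f) (t *s x) = t ^ d * reval (hcomp d f) x"
        unfolding reval_def by (rule eval_homog)
      then show ?thesis using * hcomp_in_ideal_V[OF that] by simp
    qed
    then show ?thesis by (subst D[symmetric]) (simp add: reval_hom.hom_sum)
  qed
  then have "vec.span {x} \<in> real_zeros (vanishing_ideal V)"
    using assms by (simp add: span_in_real_zeros)
  then show "vec.span {x} \<in> V" by (simp add: real_V)
qed

lemma jac_eq: "jac x = vec.span ((\<lambda>g. grad_at (complexify g) x) ` set gs)"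
proof -
  have "{\<chi> i. eval_poly (complexify (poly_grad g $ i)) x | g. g \<in> set gs} =
    (\<lambda>g. grad_at (complexify g) x) ` set gs"
    by (auto simp: grad_at_def poly_grad_def complexify_partial)
  then show ?thesis by (simp add: jac_row_span_def)
qed

lemma gens_in_ideal_V: "g \<in> set gs \<Longrightarrow> g \<in> vanishing_ideal V"
  using gens ideal_gen_base by blast

text \<open>At a point of \<open>V\<close> the row span does not depend on the choice of generators.
  This is applied to homogeneous components of generators, which need not be among
  \<open>gs\<close>.\<close>

lemma grad_in_jac:
  assumes x: "x \<noteq> 0" "vec.span {x} \<in> V" and f: "f \<in> vanishing_ideal V"
  shows "grad_at (complexify f) x \<in> jac x"
proof -
  have "complexify f \<in> ideal_gen (complexify ` set gs)"
    using f[folded gens]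
  proof (induction rule: ideal_gen_induct)
    case zero
    then show ?case by (simp add: idl.subspace_0[OF subspace_ideal_gen])
  next
    case (step a g y)
    have "complexify g \<in> ideal_gen (complexify ` set gs)"
      using step(1) by (intro ideal_gen_base imageI)
    then show ?case
      unfolding complexify_add complexify_mult
      using step(3) by (intro idl.subspace_add[OF subspace_ideal_gen] idl.subspace_scale[OF subspace_ideal_gen])
  qed
  moreover have "eval_poly g x = 0" if "g \<in> complexify ` set gs" for g
    using that gens_in_ideal_V x by (auto simp: reval_def[symmetric] in_ideal_V)
  ultimately show ?thesis
    using grad_at_ideal_gen[of "complexify ` set gs" x "complexify f"] by (simp add: jac_eq image_image)
qed

text \<open>The gradient of an inhomogeneous generator does not simply scale with the point. Those
  of its components do, and they lie in the row span by \<open>grad_in_jac\<close>.\<close>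

lemma jac_scale_subset:
  assumes x: "x \<noteq> 0" "vec.span {x} \<in> V"
  shows "jac (t *s x) \<subseteq> jac x"
proof -
  have "grad_at (complexify g) (t *s x) \<in> jac x" if g: "g \<in> set gs" for g
  proof -
    obtain D where D: "(\<Sum>d\<le>D. hcomp d (complexify g)) = complexify g" using sum_hcomp by blast
    have hc: "grad_at (hcomp d (complexify g)) (t *s x) = t ^ (d - 1) *s grad_at (hcomp d (complexify g)) x" for d
      using homog_partial[OF homog_hcomp[of d "complexify g"]]
      by (simp add: grad_at_def Finite_Cartesian_Product.vec_eq_iff eval_homog[of "d - 1"])
    have "grad_at (complexify g) (t *s x) = (\<Sum>d\<le>D. grad_at (hcomp d (complexify g)) (t *s x))"
      by (subst D[symmetric]) (simp add: grad_at_def Finite_Cartesian_Product.vec_eq_iff partial_sum eval_hom.hom_sum)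
    also have "\<dots> \<in> jac x"
      unfolding hc jac_eq
      by (intro vec.span_sum vec.span_scale)
        (use grad_in_jac[OF x hcomp_in_ideal_V[OF gens_in_ideal_V[OF g]]] in
          \<open>simp add: complexify_hcomp jac_eq\<close>)
    finally show ?thesis .
  qed
  then show ?thesis
    unfolding jac_eq[of "t *s x"] by (intro vec.span_minimal) (auto simp: jac_eq)
qed

lemma jac_scale:
  assumes x: "x \<noteq> 0" "vec.span {x} \<in> V" and t: "t \<noteq> 0"
  shows "jac (t *s x) = jac x"
proof
  show "jac (t *s x) \<subseteq> jac x" using x by (rule jac_scale_subset)
  have "jac (inverse t *s (t *s x)) \<subseteq> jac (t *s x)"
    using x t by (intro jac_scale_subset) (simp_all add: span_scale)
  then show "jac x \<subseteq> jac (t *s x)" using t by (simp add: vector_smult_assoc)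
qed

lemma dim_jac_le: "x \<noteq> 0 \<Longrightarrow> vec.span {x} \<in> V \<Longrightarrow> vec.dim (jac x) \<le> c"
proof -
  assume x: "x \<noteq> 0" "vec.span {x} \<in> V"
  have "set (map complexify gs) \<subseteq> cvanish V"
    using gens_in_ideal_V by (auto simp: vanishing_ideal_def cvanish_def)
  from jac_rank_le_codimension[OF irred codim this x]
  show ?thesis by (simp add: jac_eq image_image)
qed

lemma jac_eq': "jac x = vec.span ((\<lambda>v. \<chi> i. reval (v $ i) x) ` set (map poly_grad gs))"
proof -
  have "{\<chi> i. eval_poly (complexify (poly_grad g $ i)) x | g. g \<in> set gs} =
    (\<lambda>v. \<chi> i. reval (v $ i) x) ` set (map poly_grad gs)"
    by (auto simp: reval_def)
  then show ?thesis by (simp add: jac_row_span_def)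
qed

lemma reval_jac_minors: "(\<forall>m\<in>jac_minors. reval m x = 0) \<longleftrightarrow> vec.dim (jac x) < c"
  unfolding reval_minors jac_eq' by simp

lemma reval_aug_minors:
  "(\<forall>m\<in>aug_minors. reval m x = 0) \<longleftrightarrow> vec.dim (insert (rayleigh_vec H x) (jac x)) \<le> c"
proof -
  have "vec.dim (insert r (vec.span S)) = vec.dim (insert r S)" for r and S :: "(complex ^ 'n) set"
    by (simp add: vec.dim_insert vec.span_span)
  then show ?thesis
    unfolding reval_minors jac_eq' by (simp add: rayleigh_vec_def less_Suc_eq_le)
qed

text \<open>Criticality at a representative vector, with \<open>rayleigh_vec\<close> in place of the
  gradient, so that evaluation of polynomials applies directly.\<close>

definition good :: "complex ^ 'n \<Rightarrow> bool" where
  "good x \<longleftrightarrow> x \<noteq> 0 \<and> vec.span {x} \<in> V \<and> vec.dim (jac x) = c \<and> scalar_product x x \<noteq> 0 \<and>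
    rayleigh_vec H x \<in> jac x"

text \<open>The clauses become real polynomial equations and inequations: stability under
  conjugation is then immediate, and the equations are those of \<open>crit_base\<close>. The bound
  \<open>dim_jac_le\<close> turns rank \<open>c\<close> into the nonvanishing of some
  \<open>c\<close>-minor.\<close>

lemma good_iff:
  "good x \<longleftrightarrow> x \<noteq> 0 \<and> (\<forall>f\<in>vanishing_ideal V. reval f x = 0) \<and> (\<exists>m\<in>jac_minors. reval m x \<noteq> 0) \<and>
    reval norm_poly x \<noteq> 0 \<and> (\<forall>m\<in>aug_minors. reval m x = 0)"
proof -
  have span: "vec.span (jac x) = jac x" by (simp add: jac_row_span_def)
  \<comment> \<open>Once the Jacobian has rank \<open>c\<close>, the extended matrix has rank at
    most \<open>c\<close> exactly when the new row lies in the span.\<close>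
  have ins: "vec.dim (insert (rayleigh_vec H x) (jac x)) =
    (if rayleigh_vec H x \<in> jac x then vec.dim (jac x) else vec.dim (jac x) + 1)"
    by (simp only: vec.dim_insert span)
  show ?thesis
  proof (cases "x \<noteq> 0 \<and> vec.span {x} \<in> V")
    case True
    have "(\<exists>m\<in>jac_minors. reval m x \<noteq> 0) \<longleftrightarrow> vec.dim (jac x) = c"
      using reval_jac_minors[of x] dim_jac_le[of x] True by auto
    then show ?thesis
      using True ins unfolding good_def reval_aug_minors reval_norm_poly
      by (auto simp: span_in_V split: if_splits)
  qed (use span_in_V[of x] in \<open>auto simp: good_def\<close>)
qed

lemma good_scale: "good x \<Longrightarrow> t \<noteq> 0 \<Longrightarrow> good (t *s x)"
proof -
  assume x: "good x" and t: "t \<noteq> 0"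
  have "vec.subspace (jac x)" by (simp add: jac_row_span_def)
  then have "t ^ 3 *s rayleigh_vec H x \<in> jac x"
    using x by (intro vec.subspace_scale) (simp_all add: good_def)
  then show ?thesis
    using x t by (simp add: good_def span_scale jac_scale scalar_product_scale rayleigh_vec_scale[OF sym])
qed

lemma good_cnjv: "good x \<Longrightarrow> good (cnjv x)"
proof -
  assume "good x"
  moreover have "x \<noteq> 0 \<Longrightarrow> cnjv x \<noteq> 0"
    by (auto simp: cnjv_def Finite_Cartesian_Product.vec_eq_iff)
  ultimately show ?thesis by (simp add: good_iff reval_cnjv)
qed

lemma span_in_sing:
  assumes x: "x \<noteq> 0" "vec.span {x} \<in> V"
  shows "vec.span {x} \<in> sing \<longleftrightarrow> vec.dim (jac x) < c"
proof -
  have "vec.span {x} \<in> sing \<longleftrightarrow> \<not> (\<forall>t. t \<noteq> 0 \<longrightarrow> vec.dim (jac (t *s x)) = c)"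
    using x by (auto simp: singular_locus_def span_line)
  also have "\<dots> \<longleftrightarrow> vec.dim (jac x) \<noteq> c"
    using jac_scale[OF x] one_neq_zero by metis
  finally show ?thesis using dim_jac_le[OF x] by auto
qed

lemma span_in_crit:
  assumes x: "x \<noteq> 0" shows "vec.span {x} \<in> crit \<longleftrightarrow> good x"
proof -
  have eq: "holo_grad (rayleigh_quotient H) y \<in> jac y \<longleftrightarrow> rayleigh_vec H y \<in> jac y"
    if "scalar_product y y \<noteq> 0" for y
  proof -
    let ?k = "2 / (scalar_product y y)\<^sup>2"
    have "?k \<noteq> 0" using that by simp
    then have "?k *s v \<in> jac y \<longleftrightarrow> v \<in> jac y" for v
      unfolding jac_row_span_def using vec.span_scale
      by (metis (no_types, lifting) left_inverse vector_smult_assoc vector_smult_lid)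
    then show ?thesis by (simp add: holo_grad_rayleigh_quotient[OF sym that])
  qed
  have "vec.span {x} \<in> crit \<longleftrightarrow> vec.span {x} \<in> V \<and> vec.span {x} \<notin> sing \<and>
    (\<forall>t. t \<noteq> 0 \<longrightarrow> scalar_product (t *s x) (t *s x) \<noteq> 0 \<and>
      holo_grad (rayleigh_quotient H) (t *s x) \<in> jac (t *s x))"
    using x by (auto simp: critical_points_def span_line)
  also have "\<dots> \<longleftrightarrow> (\<forall>t. t \<noteq> 0 \<longrightarrow> good (t *s x))"
  proof
    assume *: "vec.span {x} \<in> V \<and> vec.span {x} \<notin> sing \<and>
      (\<forall>t. t \<noteq> 0 \<longrightarrow> scalar_product (t *s x) (t *s x) \<noteq> 0 \<and>
        holo_grad (rayleigh_quotient H) (t *s x) \<in> jac (t *s x))"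
    then have "vec.dim (jac x) = c" using span_in_sing[OF x] dim_jac_le[OF x] by auto
    moreover have "scalar_product x x \<noteq> 0" "holo_grad (rayleigh_quotient H) x \<in> jac x"
      using *[THEN conjunct2, THEN conjunct2, rule_format, of 1] by simp_all
    ultimately have "good x" using x * eq[of x] by (simp add: good_def)
    then show "\<forall>t. t \<noteq> 0 \<longrightarrow> good (t *s x)" using good_scale by blast
  next
    assume *: "\<forall>t. t \<noteq> 0 \<longrightarrow> good (t *s x)"
    from *[rule_format, of 1] have "good x" by simp
    then show "vec.span {x} \<in> V \<and> vec.span {x} \<notin> sing \<and>
      (\<forall>t. t \<noteq> 0 \<longrightarrow> scalar_product (t *s x) (t *s x) \<noteq> 0 \<and>
        holo_grad (rayleigh_quotient H) (t *s x) \<in> jac (t *s x))"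
      using * span_in_sing[of x] by (auto simp: good_def eq)
  qed
  also have "\<dots> \<longleftrightarrow> good x" using good_scale by (metis one_neq_zero vector_smult_lid)
  finally show ?thesis .
qed

lemma sing_proj: "sing \<subseteq> proj_space"
  using V_proj by (auto simp: singular_locus_def)

lemma crit_proj: "crit \<subseteq> proj_space"
  using V_proj by (auto simp: critical_points_def)

lemma jac_minor_vanishes_on_sing: "m \<in> jac_minors \<Longrightarrow> m \<in> vanishing_ideal sing"
proof -
  assume m: "m \<in> jac_minors"
  have "reval m x = 0" if "x \<noteq> 0" "vec.span {x} \<in> sing" for x
  proof -
    have "vec.span {x} \<in> V" using that(2) by (simp add: singular_locus_def)
    then show ?thesis using span_in_sing[of x] reval_jac_minors[of x] that m by blast
  qed
  then show ?thesis by (simp add: in_vanishing_ideal[OF sing_proj])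
qed

lemma subspace_crit_base: "idl.subspace crit_base"
  by (intro subspace_ideal_sum subspace_vanishing_ideal subspace_ideal_gen)

lemma crit_base_zero:
  "(\<forall>f\<in>crit_base. reval f x = 0) \<longleftrightarrow>
    (\<forall>f\<in>vanishing_ideal V. reval f x = 0) \<and> (\<forall>m\<in>aug_minors. reval m x = 0)"
proof
  assume *: "\<forall>f\<in>crit_base. reval f x = 0"
  have "f \<in> crit_base" if "f \<in> vanishing_ideal V" for f
    using that idl.subspace_0[OF subspace_ideal_gen, of aug_minors] unfolding ideal_sum_def
    by (intro CollectI exI[of _ f] exI[of _ 0]) simp
  moreover have "m \<in> crit_base" if "m \<in> aug_minors" for m
    using that idl.subspace_0[OF subspace_vanishing_ideal, of V] unfolding ideal_sum_def
    by (intro CollectI exI[of _ 0] exI[of _ m]) (simp add: ideal_gen_base)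
  ultimately show "(\<forall>f\<in>vanishing_ideal V. reval f x = 0) \<and> (\<forall>m\<in>aug_minors. reval m x = 0)"
    using * by blast
next
  assume *: "(\<forall>f\<in>vanishing_ideal V. reval f x = 0) \<and> (\<forall>m\<in>aug_minors. reval m x = 0)"
  have "reval g x = 0" if "g \<in> ideal_gen aug_minors" for g
    using that by (induction rule: ideal_gen_induct) (use * in \<open>auto simp: reval_hom.hom_add reval_hom.hom_mult\<close>)
  then show "\<forall>f\<in>crit_base. reval f x = 0"
    using * by (auto simp: ideal_sum_def reval_hom.hom_add)
qed

text \<open>A \<open>c\<close>-minor that is nonzero at \<open>x\<close>, times
  \<open>norm_poly\<close>, lies in the ideal by which one saturates. Its powers multiply
  \<open>f\<close> into the base ideal and can be cancelled at \<open>x\<close>.\<close>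

lemma good_vanish:
  assumes f: "f \<in> critical_ideal gs c V H" and x: "good x"
  shows "reval f x = 0"
proof -
  obtain m where m: "m \<in> jac_minors" "reval m x \<noteq> 0" and q: "reval norm_poly x \<noteq> 0"
    using x by (auto simp: good_iff)
  let ?g = "m * norm_poly"
  have "?g \<in> bad_ideal"
    unfolding ideal_prod_def
    using jac_minor_vanishes_on_sing[OF m(1)] by (intro ideal_gen_base) (auto intro: ideal_gen_base)
  then have pow: "?g ^ k \<in> ideal_power bad_ideal k" for k
  proof (induction k)
    case (Suc k)
    then show ?case by (auto simp: ideal_prod_def[of bad_ideal] intro!: ideal_gen_base)
  qed simp
  obtain k where "\<forall>g\<in>ideal_power bad_ideal k. f * g \<in> crit_base"
    using f by (auto simp: critical_ideal_def saturation_def)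
  then have "f * ?g ^ k \<in> crit_base" using pow by blast
  moreover have "\<forall>f\<in>crit_base. reval f x = 0" using x unfolding crit_base_zero good_iff by blast
  ultimately have "reval (f * ?g ^ k) x = 0" by blast
  then show ?thesis using m q by (simp add: reval_hom.hom_mult reval_hom.hom_power)
qed

lemma crit_base_subset: "crit_base \<subseteq> critical_ideal gs c V H"
proof
  fix f assume "f \<in> crit_base"
  then have "f * g \<in> crit_base" for g
    using idl.subspace_scale[OF subspace_crit_base, of f g] by (simp add: mult.commute)
  then show "f \<in> critical_ideal gs c V H"
    unfolding critical_ideal_def saturation_def by blast
qed

text \<open>The origin is included, where \<open>norm_poly\<close> vanishes: the Nullstellensatz
  tests all affine zeros, also the one that represents no projective point.\<close>

lemma bad_ideal_vanish:
  assumes g: "g \<in> bad_ideal" and x: "x \<noteq> 0 \<Longrightarrow> vec.span {x} \<in> sing \<or> scalar_product x x = 0"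
  shows "reval g x = 0"
proof -
  have q: "reval b x = 0" if "scalar_product x x = 0" "b \<in> ideal_gen {norm_poly}" for b
    using that(2) by (induction rule: ideal_gen_induct)
      (use that(1) in \<open>auto simp: reval_hom.hom_add reval_hom.hom_mult reval_norm_poly\<close>)
  have prod: "reval (a * b) x = 0" if "a \<in> vanishing_ideal sing" "b \<in> ideal_gen {norm_poly}" for a b
  proof (cases "x \<noteq> 0 \<and> vec.span {x} \<in> sing")
    case True
    then show ?thesis using that by (auto simp: in_vanishing_ideal[OF sing_proj] reval_hom.hom_mult)
  next
    case False
    then have "scalar_product x x = 0" using x by (cases "x = 0") (auto simp: scalar_product_def)
    then show ?thesis using q that by (simp add: reval_hom.hom_mult)
  qed
  from g[unfolded ideal_prod_def] show ?thesis
    by (induction rule: ideal_gen_induct)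
      (use prod in \<open>auto simp: reval_hom.hom_add reval_hom.hom_mult\<close>)
qed

lemma vanishing_power_in_critical_ideal:
  assumes f: "\<And>x. good x \<Longrightarrow> reval f x = 0"
  shows "\<exists>M. f ^ M \<in> critical_ideal gs c V H"
proof -
  have "idl.subspace bad_ideal" by (simp add: ideal_prod_def subspace_ideal_gen)
  then obtain F where F: "finite F" "F \<subseteq> bad_ideal" "ideal_gen F = bad_ideal"
    using noetherian_finitely_generated[OF noetherian_mpoly] by blast
  have "\<exists>N. (f * g) ^ N \<in> crit_base" if g: "g \<in> F" for g
  proof (rule real_Nullstellensatz[OF subspace_crit_base])
    fix x assume "\<And>h. h \<in> crit_base \<Longrightarrow> reval h x = 0"
    then have x: "\<forall>f\<in>vanishing_ideal V. reval f x = 0" "\<forall>m\<in>aug_minors. reval m x = 0"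
      using crit_base_zero by blast+
    show "reval (f * g) x = 0"
    proof (cases "good x")
      case True
      then show ?thesis using f by (simp add: reval_hom.hom_mult)
    next
      case False
      have "vec.span {x} \<in> sing \<or> scalar_product x x = 0" if "x \<noteq> 0"
      proof -
        have "vec.span {x} \<in> V" using x that by (simp add: span_in_V)
        then show ?thesis
          using False x that reval_jac_minors[of x] span_in_sing[of x] by (auto simp: good_iff reval_norm_poly)
      qed
      then have "reval g x = 0" using bad_ideal_vanish[of g x] g F(2) by blast
      then show ?thesis by (simp add: reval_hom.hom_mult)
    qed
  qed
  then show ?thesis
    using power_in_saturation[OF noetherian_mpoly subspace_crit_base F(1), of f]
    by (simp add: F(3) critical_ideal_def)
qed

lemma crit_subset: "crit \<subseteq> real_zeros (critical_ideal gs c V H)"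
proof
  fix L assume L: "L \<in> crit"
  then obtain x where x: "x \<noteq> 0" "L = vec.span {x}" using crit_proj proj_spaceE by blast
  then show "L \<in> real_zeros (critical_ideal gs c V H)"
    using L good_vanish good_scale by (simp add: span_in_crit span_in_real_zeros)
qed

text \<open>\<open>Z\<close> is cut out by complex polynomials, but as \<open>good\<close> is stable under conjugation their real and
  imaginary parts vanish separately at the critical points.\<close>

lemma real_zeros_subset_closed:
  assumes Z: "zariski_closed Z" "crit \<subseteq> Z"
  shows "real_zeros (critical_ideal gs c V H) \<subseteq> Z"
proof
  fix L assume L: "L \<in> real_zeros (critical_ideal gs c V H)"
  then obtain x where x: "x \<noteq> 0" "L = vec.span {x}"
    using proj_zeros_subset proj_spaceE unfolding real_zeros_def by blast
  obtain S where S: "Z = proj_zeros S" using Z by (auto simp: zariski_closed_def)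
  have "eval_poly s (t *s x) = 0" if s: "s \<in> S" and t: "t \<noteq> 0" for s t
  proof -
    let ?a = "Poly_Mapping.map Re s" and ?b = "Poly_Mapping.map Im s"
    have van: "eval_poly s y = 0" if y: "good y" for y
    proof -
      have "y \<noteq> 0" using y by (simp add: good_def)
      then have "vec.span {y} \<in> proj_zeros S" using y Z S by (auto simp: span_in_crit[symmetric])
      then have "eval_poly s (1 *s y) = 0"
        using s \<open>y \<noteq> 0\<close> one_neq_zero unfolding span_in_proj_zeros[OF \<open>y \<noteq> 0\<close>] by blast
      then show ?thesis by simp
    qed
    have ab: "reval ?a y = 0 \<and> reval ?b y = 0" if y: "good y" for y
    proof -
      have "reval ?a y + \<i> * reval ?b y = 0"
        using van[OF y] by (simp add: eval_real_imag)
      \<comment> \<open>\<open>cnjv y\<close> is good as well. Conjugating the equation there turns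
        the sum into a difference, and the two equations together make both parts vanish.\<close>
      moreover have "cnj (reval ?a y) + \<i> * cnj (reval ?b y) = 0"
        using van[OF good_cnjv[OF y]] by (simp add: eval_real_imag reval_cnjv)
      then have "cnj (cnj (reval ?a y) + \<i> * cnj (reval ?b y)) = 0" by simp
      then have "reval ?a y - \<i> * reval ?b y = 0" by simp
      ultimately show ?thesis by (simp add: add_eq_0_iff)
    qed
    have "reval f (t *s x) = 0" if f: "\<And>y. good y \<Longrightarrow> reval f y = 0" for f
    proof -
      obtain M where "f ^ M \<in> critical_ideal gs c V H"
        using vanishing_power_in_critical_ideal[of f] f by blast
      then have "reval (f ^ M) (t *s x) = 0" using L x t by (simp add: span_in_real_zeros)
      then show ?thesis by (simp add: reval_hom.hom_power)
    qed
    then show ?thesis using ab by (simp add: eval_real_imag)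
  qed
  then show "L \<in> Z" using x by (simp add: S span_in_proj_zeros)
qed

lemma hull_crit: "zariski_closed hull crit = real_zeros (critical_ideal gs c V H)"
proof
  show "zariski_closed hull crit \<subseteq> real_zeros (critical_ideal gs c V H)"
    by (intro hull_minimal crit_subset) (simp add: real_zeros_def zariski_closed_proj_zeros)
  show "real_zeros (critical_ideal gs c V H) \<subseteq> zariski_closed hull crit"
    unfolding hull_def using real_zeros_subset_closed by blast
qed

text \<open>The base ideal is contained in its saturation, so a zero of the critical ideal satisfies
  all equations of \<open>good_iff\<close>; removing singular and isotropic points restores the two
  inequations.\<close>

lemma crit_eq: "crit = real_zeros (critical_ideal gs c V H) - (sing \<union> isotropic_quadric)"
proof (rule subset_antisym; rule subsetI)
  fix L assume L: "L \<in> crit"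
  then obtain x where x: "x \<noteq> 0" "L = vec.span {x}" using crit_proj proj_spaceE by blast
  then have "good x" using L by (simp add: span_in_crit)
  then show "L \<in> real_zeros (critical_ideal gs c V H) - (sing \<union> isotropic_quadric)"
    using crit_subset L x by (auto simp: span_in_sing span_in_isotropic good_def)
next
  fix L assume L: "L \<in> real_zeros (critical_ideal gs c V H) - (sing \<union> isotropic_quadric)"
  then obtain x where x: "x \<noteq> 0" "L = vec.span {x}"
    using proj_zeros_subset proj_spaceE unfolding real_zeros_def by blast
  have "reval f (1 *s x) = 0" if "f \<in> crit_base" for f
    using L x that crit_base_subset one_neq_zero unfolding x(2) Diff_iff span_in_real_zeros[OF x(1)] by blast
  then have *: "\<forall>f\<in>vanishing_ideal V. reval f x = 0" "\<forall>m\<in>aug_minors. reval m x = 0"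
    using crit_base_zero[of x] by auto
  then have "vec.span {x} \<in> V" using x by (simp add: span_in_V)
  then have "good x"
    using L x * span_in_sing[of x] reval_jac_minors[of x]
    by (auto simp: good_iff span_in_isotropic reval_norm_poly)
  then show "L \<in> crit" using x by (simp add: span_in_crit)
qed

text \<open>A finite set of points is closed, so taking the closure adds nothing.\<close>

lemma crit_finite:
  assumes "finite crit" shows "crit = real_zeros (critical_ideal gs c V H)"
  using zariski_closed_finite[OF assms crit_proj] real_zeros_subset_closed crit_subset by blast

end

text \<open>A saturation cuts out a Zariski closure, which can exceed the set of critical points.
  The second clause confines the excess to singular and isotropic points, and the third excludes it
  when there are finitely many critical points.\<close>

theorem proposition2p2:
  fixes V :: "(complex ^ 'n::finite) set set"
    and gs :: "('n, real) mpoly list"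
    and c :: nat
    and H :: "real ^ 'n ^ 'n"
  assumes "irreducible_variety V"
    and "has_codimension V c"
    and "\<not> V \<subseteq> isotropic_quadric"
    and "real_zeros (vanishing_ideal V) = V"
    and "ideal_gen (set gs) = vanishing_ideal V"
    and "transpose H = H"
  shows "zariski_closed hull critical_points gs c V H = real_zeros (critical_ideal gs c V H) \<and>
    critical_points gs c V H =
      real_zeros (critical_ideal gs c V H) - (singular_locus gs c V \<union> isotropic_quadric) \<and>
    (finite (critical_points gs c V H) \<longrightarrow>
      critical_points gs c V H = real_zeros (critical_ideal gs c V H))"
proof -
  interpret rayleigh_problem V gs c H
    by unfold_locales (use assms in simp_all)
  show ?thesis using hull_crit crit_eq crit_finite by blast
qed

end
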